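(* Let $\mathcal{R}=\{L_i\xleftarrow{f_i}K_i\xrightarrow{g_i}R_i\}_{i\in\mathcal{I}}$ be a left-connected rewriting system over a signature $\Sigma$, and consider the procedure (Algorithm 3) described below. (Correctness) Every cospan $L_i+L_j\xrightarrow{\epsilon_{ij\gamma};\epsilon_{ij\gamma'}}S_{ij\gamma'}\xleftarrow{[\subseteq,\subseteq]}in(S_{ij\gamma'})+out(S_{ij\gamma'})$ output by the procedure determines a critical pair, i.e. $\iota_1;\epsilon_{ij\gamma};\epsilon_{ij\gamma'}$ and $\iota_2;\epsilon_{ij\gamma};\epsilon_{ij\gamma'}$ are mono, $\epsilon_{ij\gamma};\epsilon_{ij\gamma'}$ is epi, $in(S_{ij\gamma'})\xrightarrow{\subseteq}S_{ij\gamma'}\xleftarrow{\subseteq}out(S_{ij\gamma'})$ is an ma-cospan, and the two derivations from this ma-cospan with these matches via the $i$-th and $j$-th rules form a critical pair. (Exhaustiveness) Conversely, for every $i,j\in\mathcal{I}$ and every critical pair given by a cospan $L_i+L_j\twoheadrightarrow X\xleftarrow{[\subseteq,\subseteq]}in(X)+out(X)$, the procedure yields this cospan (up to isomorphism of $X$ compatible with the maps from $L_i+L_j$ and the interfaces).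
   Context: A signature $\Sigma$ is a set of triples $(x,n,m)$ (label, arity, coarity). A $\Sigma$-hypergraph $G=(V,E,s,t,l)$ has finite sets $V$ (nodes), $E$ (hyperedges), maps $s,t\colon E\to V^*$ (lists of sources/targets) and a labelling $l\colon E\to\Sigma$ sending a hyperedge with $n$ sources and $m$ targets to some $(x,n,m)$. Morphisms preserve sources, targets and labels; they form the category $\mathbf{Hyp}_\Sigma$, where colimits (coproducts $+$, coequalisers $\mathtt{coeq}$) are computed componentwise and monos/epis are injective/surjective on nodes and hyperedges. Composition is written $f;g$; $\iota_1,\iota_2$ are coprojections. A hypergraph is discrete if it has no hyperedges. A path is a list of hyperedges $[e_1,\dots,e_n]$ with some target of $e_k$ equal to a source of $e_{k+1}$ for each $k$; it goes from $v$ to $v'$ if $v$ is a source of $e_1$ and $v'$ a target of $e_n$; a cycle is a path with some source of $e_1$ a target of $e_n$. In-degree (out-degree) of a node $v$: number of pairs $(e,i)$ with $v$ the $i$-th target (source) of $e$; $in(H)$, $out(H)$: nodes of in-degree $0$, out-degree $0$. $H$ is ma (monogamous acyclic) if it has no cycle and all in- and out-degrees are $\le 1$. A cospan $I\to H\leftarrow O$ with $I,O$ discrete is an ma-cospan if $H$ is ma and the legs are mono with images $in(H)$ and $out(H)$. $H$ is strongly connected if for all $x\in in(H)$, $y\in out(H)$ there is a path from $x$ to $y$. A left-connected rule is a span $L\xleftarrow{[i_L,o_L]}K=I+O\xrightarrow{[i_R,o_R]}R$ with $I,O$ discrete, $I\to L\leftarrow O$ and $I\to R\leftarrow O$ ma-cospans,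 $[i_L,o_L]$ mono and $L$ strongly connected; a left-connected rewriting system is a finite set of such rules. A convex match is a mono $m\colon L\to G$ such that every path in $G$ between two nodes of $m(L)$ has all its hyperedges in $m(L)$. A derivation between ma-cospans $n\to G\leftarrow m$ and $n\to H\leftarrow m$ via a rule $L\leftarrow K\to R$ is given by a convex match $L\to G$, a hypergraph $C$ and a diagram $G\leftarrow C\to H$, $K\to C$, $R\to H$, $n+m\to C$ in which $K,L,C,G$ and $K,R,C,H$ are pushout squares (the left one a boundary complement, automatic for left-connected systems) and everything commutes with the interfaces; for left-connected systems mono matches are automatically convex and pushout complements exist uniquely, so a derivation from a given ma-cospan is determined by the rule and a mono match. A pre-critical pair consists of two derivations, via rules $L_1\leftarrow K_1\to R_1$ and $L_2\leftarrow K_2\to R_2$ with pushout complements $C_1,C_2$, from a common ma-cospan $n\to S\leftarrow m$ with matches $m_1,m_2$ such that $[m_1,m_2]\colon L_1+L_2\to S$ is epi; it is parallel if there exist $g_1\colon L_1\to C_2$, $g_2\colon L_2\to C_1$ with $g_1$ followed by $C_2\to S$ equal to $m_1$ and $g_2$ followed by $C_1\to S$ equal to $m_2$; it is critical if not parallel. For left-connected systems a pre-critical pair is thus determined by a cospan $L_1+L_2\twoheadrightarrow S\leftarrow n+m$ whose left leg is epi with mono restrictions to $L_1$ and $L_2$ and with $n\to S\leftarrow m$ an ma-cospan. An independent edge set on the complete bipartite graph $K_{A,B}$ (vertices $A+B$, an edge between each element of $A$ and each element of $B$) is a set of its edges no two sharing a vertex. The procedure (Algorithm 3): for every ordered pair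 $(i,j)\in\mathcal{I}^2$, and for every set $M$ of pairs $(e,e')$ with $e$ a hyperedge of $L_i$, $e'$ a hyperedge of $L_j$ and $l(e)=l(e')$, such that $M$ is an independent edge set (no hyperedge occurs in two pairs), do: let $\gamma$ be the induced hypergraph of $M$, whose hyperedges are the pairs $(e,e')\in M$ and whose nodes are the pairs $(v,v')$ such that for some $(e,e')\in M$ and some $k$, $v$ and $v'$ are the $k$-th sources (or the $k$-th targets) of $e$ and $e'$ respectively, the sources/targets of $(e,e')$ being the componentwise pairs, with projections $p_1^\gamma\colon\gamma\to L_i$, $p_2^\gamma\colon\gamma\to L_j$. If $\gamma$ has at least one hyperedge: let $\epsilon_{ij\gamma}\colon L_i+L_j\to S_{ij\gamma}$ be the coequaliser of $p_1^\gamma;\iota_1$ and $p_2^\gamma;\iota_2$; set $I_1=in(S_{ij\gamma})\cap\epsilon_{ij\gamma}(\iota_1(in(L_i)))$, $I_2=in(S_{ij\gamma})\cap\epsilon_{ij\gamma}(\iota_2(in(L_j)))$, $O_1=out(S_{ij\gamma})\cap\epsilon_{ij\gamma}(\iota_1(out(L_i)))$, $O_2=out(S_{ij\gamma})\cap\epsilon_{ij\gamma}(\iota_2(out(L_j)))$. For every $N$ that is either an independent edge set on $K_{I_1,O_2}$ or an independent edge set on $K_{I_2,O_1}$, let $\gamma'$ be the discrete hypergraph with nodes the pairs in $N$ and projections $p_1^{\gamma'},p_2^{\gamma'}\colon\gamma'\to S_{ij\gamma}$, and let $\epsilon_{ij\gamma'}\colon S_{ij\gamma}\to S_{ij\gamma'}$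 be their coequaliser. If $in(S_{ij\gamma'})\xrightarrow{\subseteq}S_{ij\gamma'}\xleftarrow{\subseteq}out(S_{ij\gamma'})$ is an ma-cospan, output $L_i+L_j\xrightarrow{\epsilon_{ij\gamma};\epsilon_{ij\gamma'}}S_{ij\gamma'}\xleftarrow{[\subseteq,\subseteq]}in(S_{ij\gamma'})+out(S_{ij\gamma'})$. *)

theory Defs
  imports Main
begin

text \<open>A signature is a set of triples (label, arity, coarity). A hyperedge is labelled
  by such a triple; well-formedness requires the triple to lie in the signature and to
  match the numbers of sources and targets.\<close>

record ('v, 'e, 'l) hgraph =
  nodes :: "'v set"
  edges :: "'e set"
  src   :: "'e \<Rightarrow> 'v list"
  tgt   :: "'e \<Rightarrow> 'v list"
  lab   :: "'e \<Rightarrow> 'l \<times> nat \<times> nat"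

type_synonym ('v, 'e, 'w, 'f) hmap = "('v \<Rightarrow> 'w) \<times> ('e \<Rightarrow> 'f)"

definition wf_hgraph :: "('l \<times> nat \<times> nat) set \<Rightarrow> ('v, 'e, 'l) hgraph \<Rightarrow> bool" where
  "wf_hgraph Sig G \<longleftrightarrow> finite (nodes G) \<and> finite (edges G) \<and>
     (\<forall>e\<in>edges G. set (src G e) \<subseteq> nodes G \<and> set (tgt G e) \<subseteq> nodes G \<and>
        lab G e \<in> Sig \<and> snd (lab G e) = (length (src G e), length (tgt G e)))"

definition is_hom :: "('v, 'e, 'l) hgraph \<Rightarrow> ('w, 'f, 'l) hgraph \<Rightarrow> ('v, 'e, 'w, 'f) hmap \<Rightarrow> bool" where
  "is_hom G H h \<longleftrightarrow> fst h ` nodes G \<subseteq> nodes H \<and> snd h ` edges G \<subseteq> edges H \<and>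
     (\<forall>e\<in>edges G. src H (snd h e) = map (fst h) (src G e) \<and>
                   tgt H (snd h e) = map (fst h) (tgt G e) \<and>
                   lab H (snd h e) = lab G e)"

definition hmono :: "('v, 'e, 'l) hgraph \<Rightarrow> ('v, 'e, 'w, 'f) hmap \<Rightarrow> bool" where
  "hmono G h \<longleftrightarrow> inj_on (fst h) (nodes G) \<and> inj_on (snd h) (edges G)"

definition hepi :: "('v, 'e, 'l) hgraph \<Rightarrow> ('w, 'f, 'l) hgraph \<Rightarrow> ('v, 'e, 'w, 'f) hmap \<Rightarrow> bool" where
  "hepi G H h \<longleftrightarrow> fst h ` nodes G = nodes H \<and> snd h ` edges G = edges H"

definition hiso :: "('v, 'e, 'l) hgraph \<Rightarrow> ('w, 'f, 'l) hgraph \<Rightarrow> ('v, 'e, 'w, 'f) hmap \<Rightarrow> bool" where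
  "hiso G H h \<longleftrightarrow> is_hom G H h \<and> bij_betw (fst h) (nodes G) (nodes H) \<and>
                   bij_betw (snd h) (edges G) (edges H)"

definition hcomp :: "('a, 'b, 'c, 'd) hmap \<Rightarrow> ('c, 'd, 'x, 'y) hmap \<Rightarrow> ('a, 'b, 'x, 'y) hmap" where
  "hcomp f g = (fst g \<circ> fst f, snd g \<circ> snd f)"

definition heq :: "('v, 'e, 'l) hgraph \<Rightarrow> ('v, 'e, 'w, 'f) hmap \<Rightarrow> ('v, 'e, 'w, 'f) hmap \<Rightarrow> bool" where
  "heq G f g \<longleftrightarrow> (\<forall>v\<in>nodes G. fst f v = fst g v) \<and> (\<forall>e\<in>edges G. snd f e = snd g e)"

definition hsum :: "('v, 'e, 'l) hgraph \<Rightarrow> ('w, 'f, 'l) hgraph \<Rightarrow> ('v + 'w, 'e + 'f, 'l) hgraph" where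
  "hsum G H = \<lparr> nodes = Inl ` nodes G \<union> Inr ` nodes H,
                edges = Inl ` edges G \<union> Inr ` edges H,
                src = case_sum (\<lambda>e. map Inl (src G e)) (\<lambda>e. map Inr (src H e)),
                tgt = case_sum (\<lambda>e. map Inl (tgt G e)) (\<lambda>e. map Inr (tgt H e)),
                lab = case_sum (lab G) (lab H) \<rparr>"

definition inj1 :: "('v, 'e, 'v + 'w, 'e + 'f) hmap" where
  "inj1 = (Inl, Inl)"

definition inj2 :: "('w, 'f, 'v + 'w, 'e + 'f) hmap" where
  "inj2 = (Inr, Inr)"

definition copair :: "('v, 'e, 'x, 'y) hmap \<Rightarrow> ('w, 'f, 'x, 'y) hmap \<Rightarrow> ('v + 'w, 'e + 'f, 'x, 'y) hmap" where
  "copair f g = (case_sum (fst f) (fst g), case_sum (snd f) (snd g))"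

definition gen_cls :: "('a \<times> 'a) set \<Rightarrow> 'a \<Rightarrow> 'a set" where
  "gen_cls R x = (R \<union> R\<inverse>)\<^sup>* `` {x}"

definition coeqV :: "('a, 'b, 'l) hgraph \<Rightarrow> ('a, 'b, 'v, 'e) hmap \<Rightarrow> ('a, 'b, 'v, 'e) hmap \<Rightarrow> ('v \<times> 'v) set" where
  "coeqV A f g = {(fst f a, fst g a) | a. a \<in> nodes A}"

definition coeqE :: "('a, 'b, 'l) hgraph \<Rightarrow> ('a, 'b, 'v, 'e) hmap \<Rightarrow> ('a, 'b, 'v, 'e) hmap \<Rightarrow> ('e \<times> 'e) set" where
  "coeqE A f g = {(snd f a, snd g a) | a. a \<in> edges A}"

definition coeq :: "('a, 'b, 'l) hgraph \<Rightarrow> ('v, 'e, 'l) hgraph \<Rightarrow> ('a, 'b, 'v, 'e) hmap \<Rightarrow> ('a, 'b, 'v, 'e) hmap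
                    \<Rightarrow> ('v set, 'e set, 'l) hgraph" where
  "coeq A B f g = \<lparr> nodes = gen_cls (coeqV A f g) ` nodes B,
                    edges = gen_cls (coeqE A f g) ` edges B,
                    src = (\<lambda>c. map (gen_cls (coeqV A f g)) (src B (SOME e. e \<in> c))),
                    tgt = (\<lambda>c. map (gen_cls (coeqV A f g)) (tgt B (SOME e. e \<in> c))),
                    lab = (\<lambda>c. lab B (SOME e. e \<in> c)) \<rparr>"

definition coeq_map :: "('a, 'b, 'l) hgraph \<Rightarrow> ('a, 'b, 'v, 'e) hmap \<Rightarrow> ('a, 'b, 'v, 'e) hmap
                        \<Rightarrow> ('v, 'e, 'v set, 'e set) hmap" where
  "coeq_map A f g = (gen_cls (coeqV A f g), gen_cls (coeqE A f g))"

text \<open>A commuting square f:A\<rightarrow>B, g:A\<rightarrow>C, h:B\<rightarrow>D, k:C\<rightarrow>D is a pushout iff the canonical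
  comparison map from the (componentwise) pushout object, i.e. the coequaliser of
  f;\<iota>1 and g;\<iota>2 into B+C, to D is an isomorphism.\<close>

definition is_pushout ::
  "('a, 'b, 'l) hgraph \<Rightarrow> ('v, 'e, 'l) hgraph \<Rightarrow> ('w, 'f, 'l) hgraph \<Rightarrow> ('x, 'y, 'l) hgraph \<Rightarrow>
   ('a, 'b, 'v, 'e) hmap \<Rightarrow> ('a, 'b, 'w, 'f) hmap \<Rightarrow> ('v, 'e, 'x, 'y) hmap \<Rightarrow> ('w, 'f, 'x, 'y) hmap \<Rightarrow> bool" where
  "is_pushout A B C D f g h k \<longleftrightarrow>
     is_hom A B f \<and> is_hom A C g \<and> is_hom B D h \<and> is_hom C D k \<and>
     heq A (hcomp f h) (hcomp g k) \<and>
     hiso (coeq A (hsum B C) (hcomp f inj1) (hcomp g inj2)) D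
          (\<lambda>c. fst (copair h k) (SOME x. x \<in> c), \<lambda>c. snd (copair h k) (SOME x. x \<in> c))"

definition discrete :: "'v set \<Rightarrow> ('v, 'e, 'l) hgraph" where
  "discrete V = \<lparr> nodes = V, edges = {}, src = (\<lambda>_. []), tgt = (\<lambda>_. []), lab = (\<lambda>_. undefined) \<rparr>"

definition indeg :: "('v, 'e, 'l) hgraph \<Rightarrow> 'v \<Rightarrow> nat" where
  "indeg G v = card {(e, i). e \<in> edges G \<and> i < length (tgt G e) \<and> tgt G e ! i = v}"

definition outdeg :: "('v, 'e, 'l) hgraph \<Rightarrow> 'v \<Rightarrow> nat" where
  "outdeg G v = card {(e, i). e \<in> edges G \<and> i < length (src G e) \<and> src G e ! i = v}"

definition ins :: "('v, 'e, 'l) hgraph \<Rightarrow> 'v set" where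
  "ins G = {v \<in> nodes G. indeg G v = 0}"

definition outs :: "('v, 'e, 'l) hgraph \<Rightarrow> 'v set" where
  "outs G = {v \<in> nodes G. outdeg G v = 0}"

definition is_path :: "('v, 'e, 'l) hgraph \<Rightarrow> 'e list \<Rightarrow> bool" where
  "is_path G es \<longleftrightarrow> es \<noteq> [] \<and> set es \<subseteq> edges G \<and>
     (\<forall>k. Suc k < length es \<longrightarrow> set (tgt G (es ! k)) \<inter> set (src G (es ! Suc k)) \<noteq> {})"

definition path_from :: "('v, 'e, 'l) hgraph \<Rightarrow> 'e list \<Rightarrow> 'v \<Rightarrow> 'v \<Rightarrow> bool" where
  "path_from G es v v' \<longleftrightarrow> is_path G es \<and> v \<in> set (src G (hd es)) \<and> v' \<in> set (tgt G (last es))"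

definition is_cycle :: "('v, 'e, 'l) hgraph \<Rightarrow> 'e list \<Rightarrow> bool" where
  "is_cycle G es \<longleftrightarrow> is_path G es \<and> set (src G (hd es)) \<inter> set (tgt G (last es)) \<noteq> {}"

definition mon_acyclic :: "('v, 'e, 'l) hgraph \<Rightarrow> bool" where
  "mon_acyclic G \<longleftrightarrow> (\<nexists>es. is_cycle G es) \<and>
     (\<forall>v\<in>nodes G. indeg G v \<le> 1 \<and> outdeg G v \<le> 1)"

definition ma_cospan :: "('l \<times> nat \<times> nat) set \<Rightarrow> ('a, 'b, 'l) hgraph \<Rightarrow> ('v, 'e, 'l) hgraph \<Rightarrow>
     ('c, 'd, 'l) hgraph \<Rightarrow> ('a, 'b, 'v, 'e) hmap \<Rightarrow> ('c, 'd, 'v, 'e) hmap \<Rightarrow> bool" where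
  "ma_cospan Sig GI H GO i oo \<longleftrightarrow>
     wf_hgraph Sig GI \<and> wf_hgraph Sig H \<and> wf_hgraph Sig GO \<and>
     edges GI = {} \<and> edges GO = {} \<and>
     is_hom GI H i \<and> is_hom GO H oo \<and> hmono GI i \<and> hmono GO oo \<and>
     mon_acyclic H \<and> fst i ` nodes GI = ins H \<and> fst oo ` nodes GO = outs H"

definition strongly_connected :: "('v, 'e, 'l) hgraph \<Rightarrow> bool" where
  "strongly_connected H \<longleftrightarrow> (\<forall>x\<in>ins H. \<forall>y\<in>outs H. \<exists>es. path_from H es x y)"

record ('v, 'e, 'l) rule =
  rL :: "('v, 'e, 'l) hgraph"
  rR :: "('v, 'e, 'l) hgraph"
  rI :: "('v, 'e, 'l) hgraph"
  rO :: "('v, 'e, 'l) hgraph"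
  iL :: "('v, 'e, 'v, 'e) hmap"
  oL :: "('v, 'e, 'v, 'e) hmap"
  iR :: "('v, 'e, 'v, 'e) hmap"
  oR :: "('v, 'e, 'v, 'e) hmap"

definition left_connected_rule :: "('l \<times> nat \<times> nat) set \<Rightarrow> ('v, 'e, 'l) rule \<Rightarrow> bool" where
  "left_connected_rule Sig r \<longleftrightarrow>
     ma_cospan Sig (rI r) (rL r) (rO r) (iL r) (oL r) \<and>
     ma_cospan Sig (rI r) (rR r) (rO r) (iR r) (oR r) \<and>
     hmono (hsum (rI r) (rO r)) (copair (iL r) (oL r)) \<and>
     strongly_connected (rL r)"

definition left_connected_system :: "('l \<times> nat \<times> nat) set \<Rightarrow> 'i set \<Rightarrow> ('i \<Rightarrow> ('v, 'e, 'l) rule) \<Rightarrow> bool" where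
  "left_connected_system Sig II rs \<longleftrightarrow> finite II \<and> (\<forall>i\<in>II. left_connected_rule Sig (rs i))"

definition convex_match :: "('v, 'e, 'l) hgraph \<Rightarrow> ('w, 'f, 'l) hgraph \<Rightarrow> ('v, 'e, 'w, 'f) hmap \<Rightarrow> bool" where
  "convex_match L G m \<longleftrightarrow> is_hom L G m \<and> hmono L m \<and>
     (\<forall>es v v'. v \<in> fst m ` nodes L \<and> v' \<in> fst m ` nodes L \<and> path_from G es v v' \<longrightarrow>
                set es \<subseteq> snd m ` edges L)"

definition is_derivation ::
  "('l \<times> nat \<times> nat) set \<Rightarrow> ('v, 'e, 'l) rule \<Rightarrow>
   ('a, 'b, 'l) hgraph \<Rightarrow> ('w, 'f, 'l) hgraph \<Rightarrow> ('c, 'd, 'l) hgraph \<Rightarrow>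
   ('a, 'b, 'w, 'f) hmap \<Rightarrow> ('c, 'd, 'w, 'f) hmap \<Rightarrow>
   ('v, 'e, 'w, 'f) hmap \<Rightarrow>
   ('x, 'y, 'l) hgraph \<Rightarrow> ('v + 'v, 'e + 'e, 'x, 'y) hmap \<Rightarrow> ('x, 'y, 'w, 'f) hmap \<Rightarrow>
   ('a + 'c, 'b + 'd, 'x, 'y) hmap \<Rightarrow>
   ('h, 'k, 'l) hgraph \<Rightarrow> ('x, 'y, 'h, 'k) hmap \<Rightarrow> ('v, 'e, 'h, 'k) hmap \<Rightarrow> bool" where
  "is_derivation Sig r n G m inG outG mt C kC cG nmC H cH rH \<longleftrightarrow>
     ma_cospan Sig n G m inG outG \<and>
     wf_hgraph Sig C \<and> wf_hgraph Sig H \<and>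
     convex_match (rL r) G mt \<and>
     is_pushout (hsum (rI r) (rO r)) (rL r) C G (copair (iL r) (oL r)) kC mt cG \<and>
     is_pushout (hsum (rI r) (rO r)) (rR r) C H (copair (iR r) (oR r)) kC rH cH \<and>
     is_hom (hsum n m) C nmC \<and>
     heq (hsum n m) (hcomp nmC cG) (copair inG outG) \<and>
     ma_cospan Sig n H m (hcomp inj1 (hcomp nmC cH)) (hcomp inj2 (hcomp nmC cH))"

definition parallel ::
  "('v, 'e, 'l) hgraph \<Rightarrow> ('v, 'e, 'l) hgraph \<Rightarrow>
   ('v, 'e, 'w, 'f) hmap \<Rightarrow> ('v, 'e, 'w, 'f) hmap \<Rightarrow>
   ('x, 'y, 'l) hgraph \<Rightarrow> ('x, 'y, 'w, 'f) hmap \<Rightarrow>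
   ('x2, 'y2, 'l) hgraph \<Rightarrow> ('x2, 'y2, 'w, 'f) hmap \<Rightarrow> bool" where
  "parallel L1 L2 m1 m2 C1 c1 C2 c2 \<longleftrightarrow>
     (\<exists>g1. is_hom L1 C2 g1 \<and> heq L1 (hcomp g1 c2) m1) \<and>
     (\<exists>g2. is_hom L2 C1 g2 \<and> heq L2 (hcomp g2 c1) m2)"

text \<open>The pair of derivations via rules r1, r2 from the ma-cospan in(S) \<subseteq> S \<supseteq> out(S) with matches
  m1, m2 is a critical pair: they are derivations, [m1,m2] is epi, and they are not parallel.
  The pushout complements are taken with the node/edge types of S and the results with the
  types of the componentwise pushout of C and R (no loss of generality up to isomorphism).\<close>

definition critical_pair ::
  "('l \<times> nat \<times> nat) set \<Rightarrow> ('v, 'e, 'l) rule \<Rightarrow> ('v, 'e, 'l) rule \<Rightarrow>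
   ('w, 'f, 'l) hgraph \<Rightarrow> ('v, 'e, 'w, 'f) hmap \<Rightarrow> ('v, 'e, 'w, 'f) hmap \<Rightarrow> bool" where
  "critical_pair Sig r1 r2 S m1 m2 \<longleftrightarrow>
     is_hom (hsum (rL r1) (rL r2)) S (copair m1 m2) \<and>
     hepi (hsum (rL r1) (rL r2)) S (copair m1 m2) \<and>
     (\<exists>(C1 :: ('w, 'f, 'l) hgraph) k1 c1 nm1 (H1 :: (('w + 'v) set, ('f + 'e) set, 'l) hgraph) cH1 rH1
       (C2 :: ('w, 'f, 'l) hgraph) k2 c2 nm2 (H2 :: (('w + 'v) set, ('f + 'e) set, 'l) hgraph) cH2 rH2.
        is_derivation Sig r1 (discrete (ins S) :: ('w, 'f, 'l) hgraph) S (discrete (outs S) :: ('w, 'f, 'l) hgraph)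
          (id, id) (id, id) m1 C1 k1 c1 nm1 H1 cH1 rH1 \<and>
        is_derivation Sig r2 (discrete (ins S) :: ('w, 'f, 'l) hgraph) S (discrete (outs S) :: ('w, 'f, 'l) hgraph)
          (id, id) (id, id) m2 C2 k2 c2 nm2 H2 cH2 rH2 \<and>
        \<not> parallel (rL r1) (rL r2) m1 m2 C1 c1 C2 c2)"

text \<open>Independent edge set of a complete bipartite graph K_{A,B}: a set of pairs in A \<times> B no two of
  which share a vertex (on either side).\<close>

definition indep_edges :: "'a set \<Rightarrow> 'b set \<Rightarrow> ('a \<times> 'b) set \<Rightarrow> bool" where
  "indep_edges A B M \<longleftrightarrow> M \<subseteq> A \<times> B \<and> (\<forall>(a, b)\<in>M. \<forall>(c, d)\<in>M. (a = c \<longleftrightarrow> b = d))"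

definition induced_graph :: "('v, 'e, 'l) hgraph \<Rightarrow> ('v, 'e, 'l) hgraph \<Rightarrow> ('e \<times> 'e) set \<Rightarrow> ('v \<times> 'v, 'e \<times> 'e, 'l) hgraph" where
  "induced_graph L1 L2 M = \<lparr>
     nodes = {(src L1 e ! k, src L2 e' ! k) | e e' k. (e, e') \<in> M \<and> k < length (src L1 e) \<and> k < length (src L2 e')}
           \<union> {(tgt L1 e ! k, tgt L2 e' ! k) | e e' k. (e, e') \<in> M \<and> k < length (tgt L1 e) \<and> k < length (tgt L2 e')},
     edges = M,
     src = (\<lambda>(e, e'). zip (src L1 e) (src L2 e')),
     tgt = (\<lambda>(e, e'). zip (tgt L1 e) (tgt L2 e')),
     lab = (\<lambda>(e, e'). lab L1 e) \<rparr>"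

definition proj1 :: "('a \<times> 'a, 'b \<times> 'b, 'a, 'b) hmap" where "proj1 = (fst, fst)"
definition proj2 :: "('a \<times> 'a, 'b \<times> 'b, 'a, 'b) hmap" where "proj2 = (snd, snd)"

text \<open>alg_output Sig II rs i j S e: the procedure, on the ordered pair (i,j), outputs the cospan
  L_i + L_j --e--> S <--[\<subseteq>,\<subseteq>]-- in(S) + out(S).\<close>

definition alg_output ::
  "('l \<times> nat \<times> nat) set \<Rightarrow> 'i set \<Rightarrow> ('i \<Rightarrow> ('v, 'e, 'l) rule) \<Rightarrow> 'i \<Rightarrow> 'i \<Rightarrow>
   (('v + 'v) set set, ('e + 'e) set set, 'l) hgraph \<Rightarrow>
   ('v + 'v, 'e + 'e, ('v + 'v) set set, ('e + 'e) set set) hmap \<Rightarrow> bool" where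
  "alg_output Sig II rs i j S e \<longleftrightarrow> i \<in> II \<and> j \<in> II \<and>
     (\<exists>M N.
       let Li = rL (rs i); Lj = rL (rs j);
           \<Gamma> = induced_graph Li Lj M;
           S0 = coeq \<Gamma> (hsum Li Lj) (hcomp proj1 inj1) (hcomp proj2 inj2);
           e0 = coeq_map \<Gamma> (hcomp proj1 inj1) (hcomp proj2 inj2);
           I1 = ins S0 \<inter> fst e0 ` Inl ` ins Li;
           I2 = ins S0 \<inter> fst e0 ` Inr ` ins Lj;
           O1 = outs S0 \<inter> fst e0 ` Inl ` outs Li;
           O2 = outs S0 \<inter> fst e0 ` Inr ` outs Lj;
           \<Gamma>' = (discrete N :: (('v + 'v) set \<times> ('v + 'v) set, ('e + 'e) set, 'l) hgraph)
       in indep_edges (edges Li) (edges Lj) M \<and> (\<forall>(a, b)\<in>M. lab Li a = lab Lj b) \<and> M \<noteq> {} \<and>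
          (indep_edges I1 O2 N \<or> indep_edges I2 O1 N) \<and>
          S = coeq \<Gamma>' S0 (fst, id) (snd, id) \<and>
          e = hcomp e0 (coeq_map \<Gamma>' (fst, id) (snd, id)) \<and>
          ma_cospan Sig (discrete (ins S) :: (('v + 'v) set set, ('e + 'e) set set, 'l) hgraph) S
                        (discrete (outs S) :: (('v + 'v) set set, ('e + 'e) set set, 'l) hgraph) (id, id) (id, id))"

end

theory Submission
  imports Defs
begin

text \<open>
  In a monogamous acyclic hypergraph S a map from a left-connected left-hand side L that is injective
  on hyperedges is already injective on nodes: L has no isolated nodes, so monogamy separates all
  nodes except an input from an output, and these are separated because the path joining them would
  become a cycle. The same argument shows that matches are convex and that rewriting preserves
  monogamy and acyclicity. Hence every output of the procedure consists of two derivations, and since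
  M is not empty the matches share a hyperedge, which excludes parallelism.

  Conversely, if the two matches of a pair share no hyperedge, both factor through the complements,
  so a critical pair on X has a shared hyperedge. Let M be all pairs of hyperedges with the same image.
  By monogamy the only identifications of nodes not already forced by M are between an input of one
  left-hand side and an output of the other; if they occurred in both directions, the connecting
  paths would close a cycle in X. So they form an admissible N, and the quotient is X.
\<close>

section \<open>Degrees, paths and monogamy\<close>

text \<open>The procedure controls only hyperedges: \<open>M\<close> makes both maps injective on
  them by construction. Injectivity on nodes, convexity, the complement and the result of rewriting
  all have to be derived from the final check that the quotient is monogamous and acyclic. The
  obstacle in the rewriting step is that the right-hand leg K -> R may merge an input with an
  output, so the complement need not embed into the result. Pushouts are therefore recognised by
  which nodes get identified, and monogamy of the result rests on unmatched edges never ending in an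
  output and never starting in an input of the match. \<open>critical_pair\<close> fixes the types
  of complement and result, hence both are built explicitly. In the converse direction the
  complements are arbitrary; injectivity of [i_L, o_L] makes C -> G injective, so that maps can be
  lifted through it. Paths and cycles are handled through \<open>adj\<close>, a relation on
  hyperedges: absence of cycles becomes \<open>acyclic\<close>, and concatenation of paths becomes
  transitivity of a closure.\<close>

definition adj :: "('v, 'e, 'l) hgraph \<Rightarrow> 'e rel" where
  "adj G = {(e, e'). e \<in> edges G \<and> e' \<in> edges G \<and> set (tgt G e) \<inter> set (src G e') \<noteq> {}}"

lemma finite_adj: "finite (edges G) \<Longrightarrow> finite (adj G)"
  by (rule finite_subset[of _ "edges G \<times> edges G"]) (auto simp: adj_def)

lemma indeg_eq_0_iff:
  assumes "finite (edges G)"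
  shows "indeg G v = 0 \<longleftrightarrow> (\<forall>e\<in>edges G. v \<notin> set (tgt G e))"
proof -
  have "finite {(e, i). e \<in> edges G \<and> i < length (tgt G e) \<and> tgt G e ! i = v}"
    by (rule finite_subset[of _ "Sigma (edges G) (\<lambda>e. {..<length (tgt G e)})"]) (use assms in auto)
  then show ?thesis
    by (auto simp: indeg_def in_set_conv_nth)
qed

lemma outdeg_eq_0_iff:
  assumes "finite (edges G)"
  shows "outdeg G v = 0 \<longleftrightarrow> (\<forall>e\<in>edges G. v \<notin> set (src G e))"
proof -
  have "finite {(e, i). e \<in> edges G \<and> i < length (src G e) \<and> src G e ! i = v}"
    by (rule finite_subset[of _ "Sigma (edges G) (\<lambda>e. {..<length (src G e)})"]) (use assms in auto)
  then show ?thesis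
    by (auto simp: outdeg_def in_set_conv_nth)
qed

lemma indeg_le_1_iff:
  assumes "finite (edges G)"
  shows "indeg G v \<le> 1 \<longleftrightarrow>
    (\<forall>e\<in>edges G. \<forall>e'\<in>edges G. \<forall>i<length (tgt G e). \<forall>j<length (tgt G e').
       tgt G e ! i = v \<longrightarrow> tgt G e' ! j = v \<longrightarrow> e = e' \<and> i = j)"
proof -
  have "finite {(e, i). e \<in> edges G \<and> i < length (tgt G e) \<and> tgt G e ! i = v}"
    by (rule finite_subset[of _ "Sigma (edges G) (\<lambda>e. {..<length (tgt G e)})"]) (use assms in auto)
  from card_le_Suc0_iff_eq[OF this] show ?thesis
    unfolding indeg_def One_nat_def by fastforce
qed

lemma outdeg_le_1_iff:
  assumes "finite (edges G)"
  shows "outdeg G v \<le> 1 \<longleftrightarrow>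
    (\<forall>e\<in>edges G. \<forall>e'\<in>edges G. \<forall>i<length (src G e). \<forall>j<length (src G e').
       src G e ! i = v \<longrightarrow> src G e' ! j = v \<longrightarrow> e = e' \<and> i = j)"
proof -
  have "finite {(e, i). e \<in> edges G \<and> i < length (src G e) \<and> src G e ! i = v}"
    by (rule finite_subset[of _ "Sigma (edges G) (\<lambda>e. {..<length (src G e)})"]) (use assms in auto)
  from card_le_Suc0_iff_eq[OF this] show ?thesis
    unfolding outdeg_def One_nat_def by fastforce
qed

lemma ins_iff:
  assumes "wf_hgraph Sig G"
  shows "v \<in> ins G \<longleftrightarrow> v \<in> nodes G \<and> (\<forall>e\<in>edges G. v \<notin> set (tgt G e))"
  using assms by (simp add: ins_def indeg_eq_0_iff wf_hgraph_def)

lemma outs_iff: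
  assumes "wf_hgraph Sig G"
  shows "v \<in> outs G \<longleftrightarrow> v \<in> nodes G \<and> (\<forall>e\<in>edges G. v \<notin> set (src G e))"
  using assms by (simp add: outs_def outdeg_eq_0_iff wf_hgraph_def)

lemma ins_outs_nodes: "v \<in> ins G \<Longrightarrow> v \<in> nodes G" "v \<in> outs G \<Longrightarrow> v \<in> nodes G"
  by (simp_all add: ins_def outs_def)

lemma wf_hgraphD:
  assumes "wf_hgraph Sig G"
  shows "finite (nodes G)" "finite (edges G)"
    "\<And>e v. e \<in> edges G \<Longrightarrow> v \<in> set (src G e) \<Longrightarrow> v \<in> nodes G"
    "\<And>e v. e \<in> edges G \<Longrightarrow> v \<in> set (tgt G e) \<Longrightarrow> v \<in> nodes G"
    "\<And>e. e \<in> edges G \<Longrightarrow> lab G e \<in> Sig"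
    "\<And>e. e \<in> edges G \<Longrightarrow> snd (lab G e) = (length (src G e), length (tgt G e))"
  using assms by (auto simp: wf_hgraph_def)

lemma is_path_Cons:
  "is_path G (e # es) \<longleftrightarrow> e \<in> edges G \<and> (es = [] \<or> (is_path G es \<and> (e, hd es) \<in> adj G))"
proof (cases es)
  case Nil
  then show ?thesis by (simp add: is_path_def)
next
  case (Cons a as)
  have "(\<forall>k. Suc k < length (e # es) \<longrightarrow> P ((e # es) ! k) ((e # es) ! Suc k)) \<longleftrightarrow>
    P e (hd es) \<and> (\<forall>k. Suc k < length es \<longrightarrow> P (es ! k) (es ! Suc k))" for P
    using Cons by (auto simp: nth_Cons split: nat.splits)
  from this[of "\<lambda>a b. set (tgt G a) \<inter> set (src G b) \<noteq> {}"] show ?thesis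
    using Cons by (auto simp: is_path_def adj_def)
qed

lemma is_path_hd_rtrancl:
  assumes "is_path G es" "e \<in> set es"
  shows "(hd es, e) \<in> (adj G)\<^sup>*"
  using assms
proof (induction es)
  case (Cons a es)
  then show ?case
    by (cases "es = []") (auto simp: is_path_Cons intro: converse_rtrancl_into_rtrancl)
qed auto

lemma is_path_rtrancl_last:
  assumes "is_path G es" "e \<in> set es"
  shows "(e, last es) \<in> (adj G)\<^sup>*"
  using assms
proof (induction es arbitrary: e)
  case (Cons a es)
  show ?case
  proof (cases "es = []")
    case False
    then have *: "is_path G es" "(a, hd es) \<in> adj G" using Cons.prems by (auto simp: is_path_Cons)
    then have "(hd es, last es) \<in> (adj G)\<^sup>*" using Cons.IH False by simp
    with * Cons show ?thesis using False by (auto intro: converse_rtrancl_into_rtrancl)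
  qed (use Cons.prems in auto)
qed auto

lemma rtrancl_adj_imp_path:
  assumes "(e, e') \<in> (adj G)\<^sup>*" "e' \<in> edges G"
  shows "\<exists>es. is_path G es \<and> hd es = e \<and> last es = e'"
  using assms
proof (induction rule: converse_rtrancl_induct)
  case base
  then show ?case by (intro exI[of _ "[e']"]) (simp add: is_path_Cons)
next
  case (step y z)
  then obtain es where "is_path G es" "hd es = z" "last es = e'" by blast
  moreover from this have "es \<noteq> []" by (auto simp: is_path_def)
  ultimately show ?case using step.hyps
    by (intro exI[of _ "y # es"]) (auto simp: is_path_Cons adj_def)
qed

text \<open>A closed walk of \<open>adj\<close> splits off its last step, and what remains is a path
  whose end meets its start. Conversely, the condition that closes a cycle is exactly one more
  \<open>adj\<close> step from its last edge to its first.\<close>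

lemma no_cycle_iff_acyclic: "(\<nexists>es. is_cycle G es) \<longleftrightarrow> acyclic (adj G)"
proof
  assume *: "\<nexists>es. is_cycle G es"
  show "acyclic (adj G)"
    unfolding acyclic_def
  proof (intro allI notI)
    fix e assume "(e, e) \<in> (adj G)\<^sup>+"
    then obtain e' where e': "(e, e') \<in> (adj G)\<^sup>*" "(e', e) \<in> adj G" by (auto dest: tranclD2)
    then obtain es where "is_path G es" "hd es = e" "last es = e'"
      using rtrancl_adj_imp_path[of e e' G] by (auto simp: adj_def)
    with e'(2) have "is_cycle G es" by (auto simp: is_cycle_def adj_def)
    with * show False by blast
  qed
next
  assume *: "acyclic (adj G)"
  show "\<nexists>es. is_cycle G es"
  proof
    assume "\<exists>es. is_cycle G es"
    then obtain es where es: "is_path G es" "set (src G (hd es)) \<inter> set (tgt G (last es)) \<noteq> {}"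
      by (auto simp: is_cycle_def)
    then have "es \<noteq> []" "set es \<subseteq> edges G" by (auto simp: is_path_def)
    with es have "(last es, hd es) \<in> adj G" by (force simp: adj_def)
    moreover have "(hd es, last es) \<in> (adj G)\<^sup>*"
      using is_path_rtrancl_last[OF es(1)] \<open>es \<noteq> []\<close> by simp
    ultimately have "(hd es, hd es) \<in> (adj G)\<^sup>+" by (rule rtrancl_into_trancl1[rotated])
    with * show False by (auto simp: acyclic_def)
  qed
qed

text \<open>A degree counts pairs of an edge and a position, so degree at most one means that a node
  occurs at most once in all target (source) lists. The nodes drop out of the quantification because
  well-formedness places every list entry among them.\<close>

lemma mon_acyclic_iff:
  assumes "wf_hgraph Sig G"
  shows "mon_acyclic G \<longleftrightarrow> acyclic (adj G) \<and>
    (\<forall>e\<in>edges G. \<forall>e'\<in>edges G. \<forall>i<length (tgt G e). \<forall>j<length (tgt G e').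
       tgt G e ! i = tgt G e' ! j \<longrightarrow> e = e' \<and> i = j) \<and>
    (\<forall>e\<in>edges G. \<forall>e'\<in>edges G. \<forall>i<length (src G e). \<forall>j<length (src G e').
       src G e ! i = src G e' ! j \<longrightarrow> e = e' \<and> i = j)"
proof -
  note fin = wf_hgraphD(2)[OF assms]
  have "(\<forall>v\<in>nodes G. indeg G v \<le> 1) \<longleftrightarrow>
     (\<forall>e\<in>edges G. \<forall>e'\<in>edges G. \<forall>i<length (tgt G e). \<forall>j<length (tgt G e').
       tgt G e ! i = tgt G e' ! j \<longrightarrow> e = e' \<and> i = j)"
    unfolding indeg_le_1_iff[OF fin] using wf_hgraphD(4)[OF assms] by (metis nth_mem)
  moreover have "(\<forall>v\<in>nodes G. outdeg G v \<le> 1) \<longleftrightarrow>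
     (\<forall>e\<in>edges G. \<forall>e'\<in>edges G. \<forall>i<length (src G e). \<forall>j<length (src G e').
       src G e ! i = src G e' ! j \<longrightarrow> e = e' \<and> i = j)"
    unfolding outdeg_le_1_iff[OF fin] using wf_hgraphD(3)[OF assms] by (metis nth_mem)
  ultimately show ?thesis
    unfolding mon_acyclic_def no_cycle_iff_acyclic by blast
qed

lemma mon_acyclicD:
  assumes "mon_acyclic G" "wf_hgraph Sig G"
  shows "acyclic (adj G)"
    "\<And>e e' i j. \<lbrakk>e \<in> edges G; e' \<in> edges G; i < length (tgt G e); j < length (tgt G e');
       tgt G e ! i = tgt G e' ! j\<rbrakk> \<Longrightarrow> e = e' \<and> i = j"
    "\<And>e e' i j. \<lbrakk>e \<in> edges G; e' \<in> edges G; i < length (src G e); j < length (src G e');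
       src G e ! i = src G e' ! j\<rbrakk> \<Longrightarrow> e = e' \<and> i = j"
  using assms mon_acyclic_iff[OF assms(2)] by blast+

lemma mon_acyclic_edge_unique:
  assumes "mon_acyclic G" "wf_hgraph Sig G" "e \<in> edges G" "e' \<in> edges G"
  shows "v \<in> set (tgt G e) \<Longrightarrow> v \<in> set (tgt G e') \<Longrightarrow> e = e'"
    "v \<in> set (src G e) \<Longrightarrow> v \<in> set (src G e') \<Longrightarrow> e = e'"
  using mon_acyclicD(2,3)[OF assms(1,2) assms(3,4)] by (metis in_set_conv_nth)+

lemma path_fromE:
  assumes "path_from G es v v'"
  obtains e e' where "e \<in> edges G" "e' \<in> edges G" "v \<in> set (src G e)" "v' \<in> set (tgt G e')"
    "(e, e') \<in> (adj G)\<^sup>*"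
proof
  have p: "is_path G es" "es \<noteq> []" "set es \<subseteq> edges G"
    using assms by (auto simp: path_from_def is_path_def)
  then show "hd es \<in> edges G" "last es \<in> edges G" by (simp_all add: subsetD)
  show "v \<in> set (src G (hd es))" "v' \<in> set (tgt G (last es))"
    using assms by (auto simp: path_from_def)
  show "(hd es, last es) \<in> (adj G)\<^sup>*" using is_path_rtrancl_last[OF p(1)] p(2) by simp
qed

section \<open>Homomorphisms\<close>

lemma is_homD:
  assumes "is_hom G H h"
  shows "v \<in> nodes G \<Longrightarrow> fst h v \<in> nodes H" "e \<in> edges G \<Longrightarrow> snd h e \<in> edges H"
    "e \<in> edges G \<Longrightarrow> src H (snd h e) = map (fst h) (src G e)"
    "e \<in> edges G \<Longrightarrow> tgt H (snd h e) = map (fst h) (tgt G e)"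
    "e \<in> edges G \<Longrightarrow> lab H (snd h e) = lab G e"
  using assms by (auto simp: is_hom_def)

lemma is_hom_adj:
  assumes "is_hom G H h" "(e, e') \<in> adj G"
  shows "(snd h e, snd h e') \<in> adj H"
  using assms by (auto simp: is_hom_def adj_def)

lemma is_hom_rtrancl_adj:
  assumes "is_hom G H h" "(e, e') \<in> (adj G)\<^sup>*"
  shows "(snd h e, snd h e') \<in> (adj H)\<^sup>*"
  using assms(2) by induction (auto intro: rtrancl_into_rtrancl is_hom_adj[OF assms(1)])

lemma is_hom_trancl_adj:
  assumes "is_hom G H h" "(e, e') \<in> (adj G)\<^sup>+"
  shows "(snd h e, snd h e') \<in> (adj H)\<^sup>+"
  using assms(2) by induction (auto intro: trancl_into_trancl is_hom_adj[OF assms(1)])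

lemma is_hom_hsumD:
  assumes "is_hom (hsum G H) X h"
  shows "is_hom G X (hcomp inj1 h)" "is_hom H X (hcomp inj2 h)"
  using assms by (auto simp: is_hom_def hsum_def hcomp_def inj1_def inj2_def)

lemma is_hom_copair:
  "is_hom (hsum G H) X (copair f g) \<longleftrightarrow> is_hom G X f \<and> is_hom H X g"
  by (auto simp: is_hom_def hsum_def copair_def image_Un image_image ball_Un o_def)

lemma is_hom_hcomp:
  assumes "is_hom G H f" "is_hom H X g"
  shows "is_hom G X (hcomp f g)"
  unfolding is_hom_def using is_homD[OF assms(1)] is_homD[OF assms(2)] by (auto simp: hcomp_def)

lemma is_hom_inj: "is_hom G (hsum G H) inj1" "is_hom H (hsum G H) inj2"
  by (auto simp: is_hom_def hsum_def inj1_def inj2_def)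

lemma copair_hcomp_inj: "copair (hcomp inj1 h) (hcomp inj2 h) = h"
  by (auto simp: copair_def hcomp_def inj1_def inj2_def fun_eq_iff prod_eq_iff split: sum.splits)

text \<open>Homomorphisms keep list positions and adjacency, so a coincidence or a cycle in
  \<open>G\<close> reappears in \<open>H\<close>; injectivity on edges brings the resulting equation
  back.\<close>

lemma mon_acyclic_pullback:
  assumes "is_hom G H h" "inj_on (snd h) (edges G)" "mon_acyclic H" "wf_hgraph Sig H" "wf_hgraph Sig G"
  shows "mon_acyclic G"
  unfolding mon_acyclic_iff[OF assms(5)]
proof (intro conjI ballI allI impI)
  show "acyclic (adj G)"
    using mon_acyclicD(1)[OF assms(3,4)] is_hom_trancl_adj[OF assms(1)] by (auto simp: acyclic_def)
next
  fix e e' i j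
  assume *: "e \<in> edges G" "e' \<in> edges G" "i < length (tgt G e)" "j < length (tgt G e')"
    "tgt G e ! i = tgt G e' ! j"
  have "snd h e = snd h e' \<and> i = j"
    using * mon_acyclicD(2)[OF assms(3,4), of "snd h e" "snd h e'" i j] is_homD[OF assms(1)] by simp
  then show "e = e'" "i = j" using assms(2) * by (auto dest: inj_onD)
next
  fix e e' i j
  assume *: "e \<in> edges G" "e' \<in> edges G" "i < length (src G e)" "j < length (src G e')"
    "src G e ! i = src G e' ! j"
  have "snd h e = snd h e' \<and> i = j"
    using * mon_acyclicD(3)[OF assms(3,4), of "snd h e" "snd h e'" i j] is_homD[OF assms(1)] by simp
  then show "e = e'" "i = j" using assms(2) * by (auto dest: inj_onD)
qed

lemma hiso_ins_outs:
  assumes "hiso G H h" "wf_hgraph Sig G" "wf_hgraph Sig H"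
  shows "fst h ` ins G = ins H" "fst h ` outs G = outs H"
proof -
  have hom: "is_hom G H h" and n: "inj_on (fst h) (nodes G)" "fst h ` nodes G = nodes H"
    and e: "snd h ` edges G = edges H"
    using assms(1) by (auto simp: hiso_def bij_betw_def)
  have t: "fst h v \<in> set (tgt H (snd h x)) \<longleftrightarrow> v \<in> set (tgt G x)"
    and s: "fst h v \<in> set (src H (snd h x)) \<longleftrightarrow> v \<in> set (src G x)"
    if "v \<in> nodes G" "x \<in> edges G" for v x
    using that is_homD(3,4)[OF hom] wf_hgraphD(3,4)[OF assms(2)]
    by (auto intro!: inj_on_image_mem_iff[OF n(1)])
  have "fst h v \<in> ins H \<longleftrightarrow> v \<in> ins G" "fst h v \<in> outs H \<longleftrightarrow> v \<in> outs G" if "v \<in> nodes G" for v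
    using that t s n(2) unfolding ins_iff[OF assms(2)] ins_iff[OF assms(3)] outs_iff[OF assms(2)] outs_iff[OF assms(3)]
    by (auto simp flip: e)
  moreover have "ins G \<subseteq> nodes G" "outs G \<subseteq> nodes G" "ins H \<subseteq> nodes H" "outs H \<subseteq> nodes H"
    by (auto simp: ins_def outs_def)
  ultimately show "fst h ` ins G = ins H" "fst h ` outs G = outs H"
    unfolding n(2)[symmetric] by blast+
qed

section \<open>Coequalisers and pushouts\<close>

lemma gen_cls_eq_iff: "gen_cls R x = gen_cls R y \<longleftrightarrow> (x, y) \<in> (R \<union> R\<inverse>)\<^sup>*"
proof
  assume "gen_cls R x = gen_cls R y"
  moreover have "y \<in> gen_cls R y" by (simp add: gen_cls_def)
  ultimately show "(x, y) \<in> (R \<union> R\<inverse>)\<^sup>*" by (auto simp: gen_cls_def)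
next
  assume *: "(x, y) \<in> (R \<union> R\<inverse>)\<^sup>*"
  have "sym ((R \<union> R\<inverse>)\<^sup>*)" by (intro sym_rtrancl) (auto simp: sym_def)
  with * have "(y, x) \<in> (R \<union> R\<inverse>)\<^sup>*" by (auto dest: symD)
  with * show "gen_cls R x = gen_cls R y"
    by (auto simp: gen_cls_def intro: rtrancl_trans)
qed

lemma gen_cls_eqI: "(x, y) \<in> R \<Longrightarrow> gen_cls R x = gen_cls R y"
  by (auto simp: gen_cls_eq_iff)

text \<open>The device for separating classes: a suitable \<open>q\<close> that respects the
  generating pairs shows that two elements are not identified.\<close>

lemma gen_cls_invariant:
  assumes "\<And>a b. (a, b) \<in> R \<Longrightarrow> q a = q b" "gen_cls R x = gen_cls R y"
  shows "q x = q y"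
  using assms(2) unfolding gen_cls_eq_iff
  by (induction rule: rtrancl_induct) (auto dest: assms(1))

text \<open>\<open>coeq\<close> and \<open>is_pushout\<close> evaluate a class at a chosen
  representative; this removes the dependence on the choice.\<close>

lemma gen_cls_some:
  assumes "\<And>a b. (a, b) \<in> R \<Longrightarrow> q a = q b"
  shows "q (SOME y. y \<in> gen_cls R x) = q x"
proof -
  have "(SOME y. y \<in> gen_cls R x) \<in> gen_cls R x"
    by (rule someI[of _ x]) (simp add: gen_cls_def)
  then have "gen_cls R x = gen_cls R (SOME y. y \<in> gen_cls R x)"
    unfolding gen_cls_eq_iff by (simp add: gen_cls_def)
  from gen_cls_invariant[where q = q, OF assms this] show ?thesis by simp
qed

text \<open>The map out of a coequaliser induced by \<open>q\<close>. It is written with the same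
  choice of representatives as the comparison map in \<open>is_pushout\<close>, so that the two
  agree by unfolding.\<close>

definition coeq_desc :: "('v, 'e, 'w, 'f) hmap \<Rightarrow> ('v set, 'e set, 'w, 'f) hmap" where
  "coeq_desc q = (\<lambda>c. fst q (SOME x. x \<in> c), \<lambda>c. snd q (SOME x. x \<in> c))"

text \<open>The lists of a class are those of a chosen edge. Generating pairs are the two images of
  one edge of \<open>A\<close>, whose lists agree position by position after passing to node
  classes.\<close>

lemma coeq_map_is_hom:
  assumes "is_hom A B f" "is_hom A B g"
    and wf: "\<And>a. a \<in> edges A \<Longrightarrow> set (src A a) \<subseteq> nodes A \<and> set (tgt A a) \<subseteq> nodes A"
  shows "is_hom B (coeq A B f g) (coeq_map A f g)"
proof -
  let ?V = "gen_cls (coeqV A f g)" and ?E = "gen_cls (coeqE A f g)"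
  have V: "?V (fst f v) = ?V (fst g v)" if "v \<in> nodes A" for v
    using that by (intro gen_cls_eqI) (auto simp: coeqV_def)
  have "map ?V (src B a) = map ?V (src B b)" "map ?V (tgt B a) = map ?V (tgt B b)" "lab B a = lab B b"
    if "(a, b) \<in> coeqE A f g" for a b
    using that V is_homD(3-5)[OF assms(1)] is_homD(3-5)[OF assms(2)] wf
    by (auto simp: coeqE_def subset_iff)
  then have
    "map ?V (src B (SOME e. e \<in> ?E e')) = map ?V (src B e')"
    "map ?V (tgt B (SOME e. e \<in> ?E e')) = map ?V (tgt B e')"
    "lab B (SOME e. e \<in> ?E e') = lab B e'" for e'
    using gen_cls_some[of "coeqE A f g" "\<lambda>e. map ?V (src B e)" e']
      gen_cls_some[of "coeqE A f g" "\<lambda>e. map ?V (tgt B e)" e']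
      gen_cls_some[of "coeqE A f g" "lab B" e'] by metis+
  then show ?thesis
    by (simp add: is_hom_def coeq_def coeq_map_def)
qed

lemma coeq_map_hepi: "hepi B (coeq A B f g) (coeq_map A f g)"
  by (simp add: hepi_def coeq_def coeq_map_def)

lemma coeq_desc_eq:
  assumes "heq A (hcomp f q) (hcomp g q)"
  shows "fst (coeq_desc q) (gen_cls (coeqV A f g) x) = fst q x"
    "snd (coeq_desc q) (gen_cls (coeqE A f g) e) = snd q e"
  using assms gen_cls_some[of "coeqV A f g" "fst q" x] gen_cls_some[of "coeqE A f g" "snd q" e]
  by (auto simp: coeq_desc_def coeqV_def coeqE_def heq_def hcomp_def)

lemma coeq_desc_is_hom:
  assumes "is_hom A B f" "is_hom A B g"
    and wf: "\<And>a. a \<in> edges A \<Longrightarrow> set (src A a) \<subseteq> nodes A \<and> set (tgt A a) \<subseteq> nodes A"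
    and q: "is_hom B X q" "heq A (hcomp f q) (hcomp g q)"
  shows "is_hom (coeq A B f g) X (coeq_desc q)"
proof -
  note hom = coeq_map_is_hom[OF assms(1-3)]
  note eq = coeq_desc_eq[OF q(2)]
  have e: "edges (coeq A B f g) = snd (coeq_map A f g) ` edges B"
    and n: "nodes (coeq A B f g) = fst (coeq_map A f g) ` nodes B"
    by (simp_all add: coeq_def coeq_map_def)
  have eq': "fst (coeq_desc q) (fst (coeq_map A f g) x) = fst q x"
    "snd (coeq_desc q) (snd (coeq_map A f g) e) = snd q e" for x e
    using eq by (simp_all add: coeq_map_def)
  show ?thesis
    unfolding is_hom_def e n
    using is_homD[OF q(1)] is_homD[OF hom] by (auto simp: eq')
qed

text \<open>A surjection \<open>q\<close> that coequalises \<open>f\<close> and \<open>g\<close> is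
  their coequaliser as soon as its kernel lies in the generated equivalence; the last two
  assumptions say this for nodes and for edges.\<close>

lemma coeq_hiso:
  assumes "is_hom A B f" "is_hom A B g"
    and wf: "\<And>a. a \<in> edges A \<Longrightarrow> set (src A a) \<subseteq> nodes A \<and> set (tgt A a) \<subseteq> nodes A"
    and q: "is_hom B X q" "heq A (hcomp f q) (hcomp g q)" "hepi B X q"
    and "\<And>x y. x \<in> nodes B \<Longrightarrow> y \<in> nodes B \<Longrightarrow> fst q x = fst q y \<Longrightarrow>
           gen_cls (coeqV A f g) x = gen_cls (coeqV A f g) y"
    and "\<And>x y. x \<in> edges B \<Longrightarrow> y \<in> edges B \<Longrightarrow> snd q x = snd q y \<Longrightarrow>
           gen_cls (coeqE A f g) x = gen_cls (coeqE A f g) y"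
  shows "hiso (coeq A B f g) X (coeq_desc q)"
proof -
  note eq = coeq_desc_eq[OF q(2)]
  have "inj_on (fst (coeq_desc q)) (nodes (coeq A B f g))"
    by (intro inj_onI) (clarsimp simp: coeq_def eq, rule assms(7))
  moreover have "inj_on (snd (coeq_desc q)) (edges (coeq A B f g))"
    by (intro inj_onI) (clarsimp simp: coeq_def eq, rule assms(8))
  moreover have "fst (coeq_desc q) ` nodes (coeq A B f g) = nodes X"
    "snd (coeq_desc q) ` edges (coeq A B f g) = edges X"
    using q(3) by (simp_all add: coeq_def image_image eq hepi_def)
  ultimately show ?thesis
    using coeq_desc_is_hom[OF assms(1-5)] by (simp add: hiso_def bij_betw_def)
qed

lemma hsum_simps [simp]:
  "nodes (hsum G H) = Inl ` nodes G \<union> Inr ` nodes H" "edges (hsum G H) = Inl ` edges G \<union> Inr ` edges H"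
  "src (hsum G H) (Inl e) = map Inl (src G e)" "src (hsum G H) (Inr e') = map Inr (src H e')"
  "tgt (hsum G H) (Inl e) = map Inl (tgt G e)" "tgt (hsum G H) (Inr e') = map Inr (tgt H e')"
  "lab (hsum G H) (Inl e) = lab G e" "lab (hsum G H) (Inr e') = lab H e'"
  by (simp_all add: hsum_def)

lemma hmap_simps [simp]:
  "fst (copair f g) (Inl v) = fst f v" "fst (copair f g) (Inr w) = fst g w"
  "snd (copair f g) (Inl e) = snd f e" "snd (copair f g) (Inr e') = snd g e'"
  "fst (hcomp h k) x = fst k (fst h x)" "snd (hcomp h k) y = snd k (snd h y)"
  "fst inj1 v = Inl v" "snd inj1 e = Inl e" "fst inj2 w = Inr w" "snd inj2 e' = Inr e'"
  by (simp_all add: copair_def hcomp_def inj1_def inj2_def)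

lemma discrete_simps [simp]: "nodes (discrete V) = V" "edges (discrete V) = {}"
  by (simp_all add: discrete_def)

lemma coeq_simps:
  "nodes (coeq A B f g) = gen_cls (coeqV A f g) ` nodes B"
  "edges (coeq A B f g) = gen_cls (coeqE A f g) ` edges B"
  by (simp_all add: coeq_def)

lemma heq_hsum_iff:
  "heq A (hcomp (hcomp f inj1) (copair h k)) (hcomp (hcomp g inj2) (copair h k)) \<longleftrightarrow>
   heq A (hcomp f h) (hcomp g k)"
  by (simp add: heq_def hcomp_def inj1_def inj2_def copair_def)

text \<open>As \<open>A\<close> has no edges, only nodes are glued. The leg \<open>k\<close> may
  merge nodes: \<open>kk\<close> asks that two nodes of \<open>C\<close> with one image be attached
  to the same node of \<open>B\<close>, which covers a right-hand side in which an input and an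
  output coincide.\<close>

lemma pushout_discreteI:
  fixes B :: "('v, 'e, 'l) hgraph" and C :: "('w, 'f, 'l) hgraph"
  assumes hom: "is_hom A B f" "is_hom A C g" "is_hom B D h" "is_hom C D k"
    and comm: "heq A (hcomp f h) (hcomp g k)" and A: "edges A = {}"
    and epi: "fst h ` nodes B \<union> fst k ` nodes C = nodes D" "snd h ` edges B \<union> snd k ` edges C = edges D"
    and inj: "inj_on (fst h) (nodes B)" "inj_on (snd h) (edges B)" "inj_on (snd k) (edges C)"
    and disj: "snd h ` edges B \<inter> snd k ` edges C = {}"
    and hk: "\<And>b c. b \<in> nodes B \<Longrightarrow> c \<in> nodes C \<Longrightarrow> fst h b = fst k c \<Longrightarrow>
               \<exists>a\<in>nodes A. fst f a = b \<and> fst g a = c"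
    and kk: "\<And>c c'. c \<in> nodes C \<Longrightarrow> c' \<in> nodes C \<Longrightarrow> fst k c = fst k c' \<Longrightarrow> c \<noteq> c' \<Longrightarrow>
               \<exists>a\<in>nodes A. \<exists>a'\<in>nodes A. fst g a = c \<and> fst g a' = c' \<and> fst f a = fst f a'"
  shows "is_pushout A B C D f g h k"
proof -
  let ?f = "hcomp f inj1 :: (_, _, 'v + 'w, 'e + 'f) hmap" and ?g = "hcomp g inj2 :: (_, _, 'v + 'w, 'e + 'f) hmap"
  let ?V = "gen_cls (coeqV A ?f ?g)" and ?E = "gen_cls (coeqE A ?f ?g)"
  have glue: "?V (Inl (fst f a)) = ?V (Inr (fst g a))" if "a \<in> nodes A" for a
    using that by (intro gen_cls_eqI) (auto simp: coeqV_def hcomp_def inj1_def inj2_def)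
  have 1: "?V (Inl b) = ?V (Inr c)" if "b \<in> nodes B" "c \<in> nodes C" "fst h b = fst k c" for b c
    using hk[OF that] glue by blast
  have 2: "?V (Inr c) = ?V (Inr c')" if "c \<in> nodes C" "c' \<in> nodes C" "fst k c = fst k c'" for c c'
  proof (cases "c = c'")
    case False
    then show ?thesis using kk[OF that] glue by metis
  qed simp
  have "hiso (coeq A (hsum B C) ?f ?g) D (coeq_desc (copair h k))"
  proof (rule coeq_hiso)
    show "is_hom A (hsum B C) ?f" "is_hom A (hsum B C) ?g"
      using hom by (auto intro: is_hom_hcomp is_hom_inj)
    show "is_hom (hsum B C) D (copair h k)" using hom by (simp add: is_hom_copair)
    show "heq A (hcomp ?f (copair h k)) (hcomp ?g (copair h k))" using comm by (rule heq_hsum_iff[THEN iffD2])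
    show "hepi (hsum B C) D (copair h k)"
      using epi by (simp add: hepi_def image_Un image_image)
  next
    fix x y
    assume xy: "x \<in> nodes (hsum B C)" "y \<in> nodes (hsum B C)" "fst (copair h k) x = fst (copair h k) y"
    show "?V x = ?V y"
    proof (cases x)
      case x: (Inl b)
      show ?thesis
      proof (cases y)
        case (Inl b')
        with x xy have "b = b'" by (intro inj_onD[OF inj(1)]) auto
        with x Inl show ?thesis by simp
      next
        case (Inr c)
        with x xy show ?thesis using 1[of b c] by auto
      qed
    next
      case x: (Inr c)
      show ?thesis
      proof (cases y)
        case (Inl b)
        with x xy show ?thesis using 1[of b c] by auto
      next
        case (Inr c')
        with x xy show ?thesis using 2[of c c'] by auto
      qed
    qed
  next
    fix x y assume "x \<in> edges (hsum B C)" "y \<in> edges (hsum B C)" "snd (copair h k) x = snd (copair h k) y"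
    then have "x = y"
      using inj(2,3) disj by (cases x; cases y) (auto simp: inj_on_eq_iff image_iff)
    then show "?E x = ?E y" by simp
  qed (simp add: A)
  then show ?thesis
    using hom comm by (simp add: is_pushout_def coeq_desc_def)
qed

lemma pushout_hepi:
  assumes "is_pushout A B C D f g h k"
  shows "nodes D = fst h ` nodes B \<union> fst k ` nodes C" "edges D = snd h ` edges B \<union> snd k ` edges C"
proof -
  have iso: "hiso (coeq A (hsum B C) (hcomp f inj1) (hcomp g inj2)) D (coeq_desc (copair h k))"
    and comm: "heq A (hcomp f h) (hcomp g k)"
    using assms by (simp_all add: is_pushout_def coeq_desc_def)
  note eq = coeq_desc_eq[OF comm[THEN heq_hsum_iff[THEN iffD2]]]
  from iso show "nodes D = fst h ` nodes B \<union> fst k ` nodes C" "edges D = snd h ` edges B \<union> snd k ` edges C"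
    by (simp_all add: hiso_def bij_betw_def coeq_simps image_image eq image_Un)
qed

text \<open>In a pushout of an injection f, a partial retraction of B + C onto C is constant on the
  classes of the glueing relation.\<close>

lemma glue_Inr_eq:
  fixes A f g
  assumes "inj_on f A" "gen_cls {(Inl (f a), Inr (g a)) | a. a \<in> A} (Inr c) =
    gen_cls {(Inl (f a), Inr (g a)) | a. a \<in> A} (Inr c')"
  shows "c = c'"
proof -
  let ?q = "case_sum (\<lambda>b. if b \<in> f ` A then Some (g (inv_into A f b)) else None) Some"
  have "?q (Inr c) = ?q (Inr c')"
    by (rule gen_cls_invariant[OF _ assms(2)]) (use assms(1) in auto)
  then show ?thesis by simp
qed

lemma glue_Inl_eq:
  fixes A f g
  assumes "inj_on g A" "gen_cls {(Inl (f a), Inr (g a)) | a. a \<in> A} (Inl c) =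
    gen_cls {(Inl (f a), Inr (g a)) | a. a \<in> A} (Inl c')"
  shows "c = c'"
proof -
  let ?q = "case_sum Some (\<lambda>b. if b \<in> g ` A then Some (f (inv_into A g b)) else None)"
  have "?q (Inl c) = ?q (Inl c')"
    by (rule gen_cls_invariant[OF _ assms(2)]) (use assms(1) in auto)
  then show ?thesis by simp
qed

text \<open>Two elements of \<open>C\<close> with one image lie in one class of the gluing, and
  injectivity of \<open>f\<close> keeps distinct elements of \<open>C\<close> in distinct classes.
  This gives access to an arbitrary pushout complement.\<close>

lemma pushout_hmono:
  fixes B :: "('v, 'e, 'l) hgraph" and C :: "('w, 'f, 'l) hgraph"
  assumes "is_pushout A B C D f g h k" "hmono A f"
  shows "hmono C k"
proof -
  let ?f = "hcomp f inj1 :: (_, _, 'v + 'w, 'e + 'f) hmap" and ?g = "hcomp g inj2 :: (_, _, 'v + 'w, 'e + 'f) hmap"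
  let ?V = "coeqV A ?f ?g" and ?E = "coeqE A ?f ?g"
  have iso: "hiso (coeq A (hsum B C) (hcomp f inj1) (hcomp g inj2)) D (coeq_desc (copair h k))"
    and comm: "heq A (hcomp f h) (hcomp g k)"
    using assms by (simp_all add: is_pushout_def coeq_desc_def)
  note eq = coeq_desc_eq[OF comm[THEN heq_hsum_iff[THEN iffD2]]]
  have inj: "inj_on (fst (coeq_desc (copair h k))) (gen_cls ?V ` nodes (hsum B C))"
    "inj_on (snd (coeq_desc (copair h k))) (gen_cls ?E ` edges (hsum B C))"
    using iso by (simp_all add: hiso_def bij_betw_def coeq_def)
  have VE: "?V = {(Inl (fst f a), Inr (fst g a)) | a. a \<in> nodes A}"
    "?E = {(Inl (snd f a), Inr (snd g a)) | a. a \<in> edges A}"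
    by (auto simp: coeqV_def coeqE_def hcomp_def inj1_def inj2_def)
  have "c = c'" if "c \<in> nodes C" "c' \<in> nodes C" "fst k c = fst k c'" for c c'
  proof -
    have "gen_cls ?V (Inr c) = gen_cls ?V (Inr c')"
      by (rule inj_onD[OF inj(1)]) (use that in \<open>simp_all add: eq\<close>)
    with assms(2) show ?thesis unfolding VE by (auto simp: hmono_def intro: glue_Inr_eq)
  qed
  moreover have "c = c'" if "c \<in> edges C" "c' \<in> edges C" "snd k c = snd k c'" for c c'
  proof -
    have "gen_cls ?E (Inr c) = gen_cls ?E (Inr c')"
      by (rule inj_onD[OF inj(2)]) (use that in \<open>simp_all add: eq\<close>)
    with assms(2) show ?thesis unfolding VE by (auto simp: hmono_def intro: glue_Inr_eq)
  qed
  ultimately show ?thesis by (auto simp: hmono_def inj_on_def)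
qed

lemma coeq_discrete:
  fixes N :: "('v \<times> 'v) set"
  shows "coeqV (discrete N :: ('v \<times> 'v, 'e, 'l) hgraph) (fst, id) (snd, id) = N"
    "coeqE (discrete N :: ('v \<times> 'v, 'e, 'l) hgraph) (fst, id) (snd, id) = {}"
  by (auto simp: coeqV_def coeqE_def)

lemma coeq_map_discrete:
  fixes N :: "('v \<times> 'v) set"
  shows "coeq_map (discrete N :: ('v \<times> 'v, 'e, 'l) hgraph) (fst, id) (snd, id) = (gen_cls N, \<lambda>x. {x})"
  by (auto simp: coeq_map_def coeq_discrete gen_cls_def)

lemma wf_hepi:
  assumes "is_hom G H h" "hepi G H h" "wf_hgraph Sig G"
  shows "wf_hgraph Sig H"
proof -
  have H: "nodes H = fst h ` nodes G" "edges H = snd h ` edges G" using assms(2) by (auto simp: hepi_def)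
  show ?thesis
    unfolding wf_hgraph_def H
    using wf_hgraphD[OF assms(3)] by (auto simp: is_homD[OF assms(1)])
qed

lemma wf_hsum: "wf_hgraph Sig G \<Longrightarrow> wf_hgraph Sig H \<Longrightarrow> wf_hgraph Sig (hsum G H)"
  by (auto simp: wf_hgraph_def ball_Un subset_iff)

lemma hepi_hcomp: "hepi G H f \<Longrightarrow> hepi H X g \<Longrightarrow> hepi G X (hcomp f g)"
  by (auto simp: hepi_def hcomp_def simp flip: image_image image_comp)

lemma ma_cospan_discrete_iff:
  "ma_cospan Sig (discrete (ins S)) S (discrete (outs S)) (id, id) (id, id) \<longleftrightarrow>
   wf_hgraph Sig S \<and> mon_acyclic S"
  by (auto simp: ma_cospan_def discrete_def wf_hgraph_def is_hom_def hmono_def ins_def outs_def)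

section \<open>Matches of left-connected rules\<close>

locale left_connected =
  fixes Sig :: "('l \<times> nat \<times> nat) set" and r :: "('v, 'e, 'l) rule"
  assumes rule: "left_connected_rule Sig r"
begin

lemma cospans:
  "ma_cospan Sig (rI r) (rL r) (rO r) (iL r) (oL r)" "ma_cospan Sig (rI r) (rR r) (rO r) (iR r) (oR r)"
  using rule by (simp_all add: left_connected_rule_def)

lemma wfL: "wf_hgraph Sig (rL r)" and wfR: "wf_hgraph Sig (rR r)"
  and maL: "mon_acyclic (rL r)" and maR: "mon_acyclic (rR r)"
  and edges_K: "edges (rI r) = {}" "edges (rO r) = {}"
  and hom_K: "is_hom (rI r) (rL r) (iL r)" "is_hom (rO r) (rL r) (oL r)"
    "is_hom (rI r) (rR r) (iR r)" "is_hom (rO r) (rR r) (oR r)"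
  and image_K: "fst (iL r) ` nodes (rI r) = ins (rL r)" "fst (oL r) ` nodes (rO r) = outs (rL r)"
    "fst (iR r) ` nodes (rI r) = ins (rR r)" "fst (oR r) ` nodes (rO r) = outs (rR r)"
  and inj_K: "inj_on (fst (iL r)) (nodes (rI r))" "inj_on (fst (oL r)) (nodes (rO r))"
    "inj_on (fst (iR r)) (nodes (rI r))" "inj_on (fst (oR r)) (nodes (rO r))"
  using cospans by (simp_all add: ma_cospan_def hmono_def)

text \<open>The inputs are the image of I and the outputs the image of O, so a common node would
  contradict injectivity of [i_L, o_L] on I + O.\<close>

lemma ins_outs_disjoint: "v \<in> ins (rL r) \<Longrightarrow> v \<notin> outs (rL r)"
proof
  assume "v \<in> ins (rL r)" "v \<in> outs (rL r)"
  then have v: "v \<in> fst (iL r) ` nodes (rI r)" "v \<in> fst (oL r) ` nodes (rO r)"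
    by (simp_all add: image_K)
  obtain x where "v = fst (iL r) x" "x \<in> nodes (rI r)" using v(1) by (rule imageE)
  moreover obtain y where "v = fst (oL r) y" "y \<in> nodes (rO r)" using v(2) by (rule imageE)
  moreover have "inj_on (case_sum (fst (iL r)) (fst (oL r))) (Inl ` nodes (rI r) \<union> Inr ` nodes (rO r))"
    using rule by (simp add: left_connected_rule_def hmono_def hsum_def copair_def)
  ultimately show False using inj_onD[of _ _ "Inl x" "Inr y"] by fastforce
qed

text \<open>An isolated node would be an input and an output at once. Since every node lies on an
  edge, maps out of the left-hand side are controlled by what they do on edges.\<close>

lemma in_or_out_edge:
  assumes "v \<in> nodes (rL r)"
  shows "(\<exists>e\<in>edges (rL r). v \<in> set (src (rL r) e)) \<or> (\<exists>e\<in>edges (rL r). v \<in> set (tgt (rL r) e))"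
  using ins_outs_disjoint[of v] assms by (auto simp: ins_iff[OF wfL] outs_iff[OF wfL])

end

text \<open>Injectivity is assumed on edges only, because this is what the choice of
  \<open>M\<close> guarantees; the remaining properties of a match are derived inside.\<close>

locale rule_match = left_connected Sig r
  for Sig :: "('l \<times> nat \<times> nat) set" and r :: "('v, 'e, 'l) rule" +
  fixes S :: "('w, 'f, 'l) hgraph" and m :: "('v, 'e, 'w, 'f) hmap"
  assumes wfS: "wf_hgraph Sig S" and maS: "mon_acyclic S"
    and hom: "is_hom (rL r) S m" and inj_edges: "inj_on (snd m) (edges (rL r))"
begin

lemma path_between:
  assumes "x \<in> ins (rL r)" "y \<in> outs (rL r)"
  obtains e e' where "e \<in> edges S" "e' \<in> edges S" "fst m x \<in> set (src S e)" "fst m y \<in> set (tgt S e')"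
    "(e, e') \<in> (adj S)\<^sup>*"
proof -
  obtain es where "path_from (rL r) es x y"
    using rule assms unfolding left_connected_rule_def strongly_connected_def by blast
  then obtain e e' where "e \<in> edges (rL r)" "e' \<in> edges (rL r)" "x \<in> set (src (rL r) e)"
    "y \<in> set (tgt (rL r) e')" "(e, e') \<in> (adj (rL r))\<^sup>*"
    by (rule path_fromE)
  then show thesis
    by (intro that[of "snd m e" "snd m e'"]) (auto simp: is_homD[OF hom] is_hom_rtrancl_adj[OF hom])
qed

text \<open>Strong connectivity closes a path that leaves the match through an output and returns
  through an input to a cycle.\<close>

lemma no_return:
  assumes "x \<in> ins (rL r)" "y \<in> outs (rL r)" "e \<in> edges S" "e' \<in> edges S"
    "fst m y \<in> set (src S e)" "fst m x \<in> set (tgt S e')" "(e, e') \<in> (adj S)\<^sup>*"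
  shows False
proof -
  obtain d d' where d: "d \<in> edges S" "d' \<in> edges S" "fst m x \<in> set (src S d)" "fst m y \<in> set (tgt S d')"
    "(d, d') \<in> (adj S)\<^sup>*"
    using path_between[OF assms(1,2)] .
  have "(e', d) \<in> adj S" "(d', e) \<in> adj S" using assms d by (auto simp: adj_def)
  with assms(7) d(5) have "(e, e) \<in> (adj S)\<^sup>+"
    by (meson rtrancl_into_trancl1 rtrancl_trans rtrancl_into_rtrancl)
  then show False using mon_acyclicD(1)[OF maS wfS] by (auto simp: acyclic_def)
qed

text \<open>If the images coincided, the path joining them would start and end at one node, and
  \<open>no_return\<close> applied to this very path gives the contradiction.\<close>

lemma outs_ins_distinct:
  assumes "x \<in> ins (rL r)" "y \<in> outs (rL r)"
  shows "fst m x \<noteq> fst m y"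
proof
  assume eq: "fst m x = fst m y"
  obtain d d' where d: "d \<in> edges S" "d' \<in> edges S" "fst m x \<in> set (src S d)" "fst m y \<in> set (tgt S d')"
    "(d, d') \<in> (adj S)\<^sup>*"
    using path_between[OF assms(1,2)] .
  with eq show False by (intro no_return[OF assms d(1,2)]) auto
qed

lemma inj_nodes: "inj_on (fst m) (nodes (rL r))"
proof (rule inj_onI)
  fix u v assume uv: "u \<in> nodes (rL r)" "v \<in> nodes (rL r)" "fst m u = fst m v"
  note uniq = mon_acyclicD(2,3)[OF maS wfS, of "snd m a" "snd m b" for a b]
  have s: "u = v" if ab: "a \<in> edges (rL r)" "b \<in> edges (rL r)" "u \<in> set (src (rL r) a)" "v \<in> set (src (rL r) b)" for a b
  proof -
    obtain i j where ij: "i < length (src (rL r) a)" "j < length (src (rL r) b)"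
      "src (rL r) a ! i = u" "src (rL r) b ! j = v"
      using ab by (auto simp: in_set_conv_nth)
    then have "snd m a = snd m b \<and> i = j" using ab uv(3) by (intro uniq(2)) (auto simp: is_homD[OF hom])
    then show ?thesis using ab ij inj_edges by (auto dest: inj_onD)
  qed
  have t: "u = v" if ab: "a \<in> edges (rL r)" "b \<in> edges (rL r)" "u \<in> set (tgt (rL r) a)" "v \<in> set (tgt (rL r) b)" for a b
  proof -
    obtain i j where ij: "i < length (tgt (rL r) a)" "j < length (tgt (rL r) b)"
      "tgt (rL r) a ! i = u" "tgt (rL r) b ! j = v"
      using ab by (auto simp: in_set_conv_nth)
    then have "snd m a = snd m b \<and> i = j" using ab uv(3) by (intro uniq(1)) (auto simp: is_homD[OF hom])
    then show ?thesis using ab ij inj_edges by (auto dest: inj_onD)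
  qed
  show "u = v"
  proof (rule ccontr)
    assume "u \<noteq> v"
    \<comment> \<open>Distinct nodes with one image cannot both be sources or both be targets, and
      neither is isolated. So one occurs only as a source and the other only as a target.\<close>
    then have "(u \<in> ins (rL r) \<and> v \<in> outs (rL r)) \<or> (v \<in> ins (rL r) \<and> u \<in> outs (rL r))"
      using in_or_out_edge[OF uv(1)] in_or_out_edge[OF uv(2)] s t uv(1,2)
      by (auto simp: ins_iff[OF wfL] outs_iff[OF wfL])
    then show False using outs_ins_distinct uv(3) by metis
  qed
qed

lemma hmono: "hmono (rL r) m"
  by (simp add: hmono_def inj_nodes inj_edges)

text \<open>A node that is not an input already receives an edge of the left-hand side, and monogamy
  of \<open>S\<close> leaves no room for a second one.\<close>

lemma tgt_in_match:
  assumes "e \<in> edges S" "v \<in> nodes (rL r)" "v \<notin> ins (rL r)" "fst m v \<in> set (tgt S e)"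
  shows "e \<in> snd m ` edges (rL r)"
proof -
  obtain x where x: "x \<in> edges (rL r)" "v \<in> set (tgt (rL r) x)" using assms(2,3) by (auto simp: ins_iff[OF wfL])
  then have "e = snd m x"
    using assms(1,4) by (intro mon_acyclic_edge_unique(1)[OF maS wfS]) (auto simp: is_homD[OF hom])
  with x show ?thesis by blast
qed

lemma src_in_match:
  assumes "e \<in> edges S" "v \<in> nodes (rL r)" "v \<notin> outs (rL r)" "fst m v \<in> set (src S e)"
  shows "e \<in> snd m ` edges (rL r)"
proof -
  obtain x where x: "x \<in> edges (rL r)" "v \<in> set (src (rL r) x)" using assms(2,3) by (auto simp: outs_iff[OF wfL])
  then have "e = snd m x"
    using assms(1,4) by (intro mon_acyclic_edge_unique(2)[OF maS wfS]) (auto simp: is_homD[OF hom])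
  with x show ?thesis by blast
qed

lemma match_edge_nodes:
  assumes "e \<in> snd m ` edges (rL r)"
  shows "v \<in> set (tgt S e) \<Longrightarrow> v \<in> fst m ` (nodes (rL r) - ins (rL r))"
    "v \<in> set (src S e) \<Longrightarrow> v \<in> fst m ` (nodes (rL r) - outs (rL r))"
proof -
  obtain x where x: "x \<in> edges (rL r)" "e = snd m x" using assms by blast
  have "set (tgt (rL r) x) \<subseteq> nodes (rL r) - ins (rL r)" "set (src (rL r) x) \<subseteq> nodes (rL r) - outs (rL r)"
    using x(1) wf_hgraphD(3,4)[OF wfL x(1)] by (auto simp: ins_iff[OF wfL] outs_iff[OF wfL])
  then show "v \<in> set (tgt S e) \<Longrightarrow> v \<in> fst m ` (nodes (rL r) - ins (rL r))"
    "v \<in> set (src S e) \<Longrightarrow> v \<in> fst m ` (nodes (rL r) - outs (rL r))"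
    unfolding x(2) is_homD(3,4)[OF hom x(1)] by auto
qed

text \<open>As long as the walk uses matched edges it stays on matched nodes. Its first unmatched
  edge therefore starts at a matched node, and by \<open>src_in_match\<close> this node is an
  output.\<close>

lemma leaves_through_output:
  assumes "(e, d) \<in> (adj S)\<^sup>*" "d \<in> edges S" "d \<notin> snd m ` edges (rL r)"
    "v \<in> fst m ` nodes (rL r)" "v \<in> set (src S e)"
  shows "\<exists>y\<in>outs (rL r). \<exists>e'\<in>edges S. fst m y \<in> set (src S e') \<and> (e', d) \<in> (adj S)\<^sup>*"
  using assms
proof (induction arbitrary: v rule: converse_rtrancl_induct)
  case base
  then show ?case using src_in_match by blast
next
  case (step e e')
  show ?case
  proof (cases "e \<in> snd m ` edges (rL r)")
    case True
    obtain w where "w \<in> set (tgt S e)" "w \<in> set (src S e')" using step.hyps(1) by (auto simp: adj_def)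
    then show ?thesis using step.IH[OF step.prems(1,2)] match_edge_nodes(1)[OF True] by blast
  next
    case False
    then have "v \<in> fst m ` outs (rL r)" using step.prems(3,4) step.hyps(1) src_in_match by (auto simp: adj_def)
    then show ?thesis using step.prems(4) step.hyps
      by (auto simp: adj_def intro: converse_rtrancl_into_rtrancl)
  qed
qed

lemma enters_through_input:
  assumes "(d, e) \<in> (adj S)\<^sup>*" "d \<in> edges S" "d \<notin> snd m ` edges (rL r)"
    "v \<in> fst m ` nodes (rL r)" "v \<in> set (tgt S e)"
  shows "\<exists>x\<in>ins (rL r). \<exists>e'\<in>edges S. fst m x \<in> set (tgt S e') \<and> (d, e') \<in> (adj S)\<^sup>*"
  using assms
proof (induction arbitrary: v rule: rtrancl_induct)
  case base
  then show ?case using tgt_in_match by blast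
next
  case (step e' e)
  show ?case
  proof (cases "e \<in> snd m ` edges (rL r)")
    case True
    obtain w where "w \<in> set (tgt S e')" "w \<in> set (src S e)" using step.hyps(2) by (auto simp: adj_def)
    then show ?thesis using step.IH[OF step.prems(1,2)] match_edge_nodes(2)[OF True] by blast
  next
    case False
    then have "v \<in> fst m ` ins (rL r)" using step.prems(3,4) step.hyps(2) tgt_in_match by (auto simp: adj_def)
    then show ?thesis using step.prems(4) step.hyps
      by (auto simp: adj_def intro: rtrancl_into_rtrancl)
  qed
qed

text \<open>An unmatched edge on a path between matched nodes would lie between an exit through an
  output and a return through an input, which \<open>no_return\<close> forbids.\<close>

lemma convex: "convex_match (rL r) S m"
  unfolding convex_match_def
proof (intro conjI allI impI hom hmono, elim conjE)
  fix es v v'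
  assume v: "v \<in> fst m ` nodes (rL r)" "v' \<in> fst m ` nodes (rL r)" and p: "path_from S es v v'"
  then have path: "is_path S es" "v \<in> set (src S (hd es))" "v' \<in> set (tgt S (last es))"
    by (auto simp: path_from_def)
  show "set es \<subseteq> snd m ` edges (rL r)"
  proof (rule subsetI, rule ccontr)
    fix d assume d: "d \<in> set es" "d \<notin> snd m ` edges (rL r)"
    then have dS: "d \<in> edges S" using path by (auto simp: is_path_def)
    obtain y e where y: "y \<in> outs (rL r)" "e \<in> edges S" "fst m y \<in> set (src S e)" "(e, d) \<in> (adj S)\<^sup>*"
      using leaves_through_output[OF is_path_hd_rtrancl[OF path(1) d(1)] dS d(2) v(1) path(2)] by blast
    obtain x e' where x: "x \<in> ins (rL r)" "e' \<in> edges S" "fst m x \<in> set (tgt S e')" "(d, e') \<in> (adj S)\<^sup>*"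
      using enters_through_input[OF is_path_rtrancl_last[OF path(1) d(1)] dS d(2) v(2) path(3)] by blast
    show False using no_return[OF x(1) y(1) y(2) x(2) y(3) x(3)] y(4) x(4) by (meson rtrancl_trans)
  qed
qed

section \<open>Rewriting at a match\<close>

text \<open>The boundary complement: inputs and outputs of the match stay, only its inner nodes and
  its edges go. Being a subgraph of \<open>S\<close> over the same types, it maps to
  \<open>S\<close> by the identity and has the type that \<open>critical_pair\<close>
  prescribes.\<close>

definition compl :: "('w, 'f, 'l) hgraph" where
  "compl = \<lparr> nodes = nodes S - fst m ` (nodes (rL r) - ins (rL r) - outs (rL r)),
     edges = edges S - snd m ` edges (rL r), src = src S, tgt = tgt S, lab = lab S \<rparr>"

definition bnd :: "('v + 'v, 'e + 'e, 'w, 'f) hmap" where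
  "bnd = hcomp (copair (iL r) (oL r)) m"

text \<open>The boundary is embedded in the complement, so the pushout of the right-hand side has a
  canonical set of representatives: all nodes of R and the complement nodes off the boundary.\<close>

definition to_res :: "'w \<Rightarrow> ('w + 'v) set" where
  "to_res c = (if c \<in> fst bnd ` nodes (hsum (rI r) (rO r))
     then {Inr (fst (copair (iR r) (oR r)) (inv_into (nodes (hsum (rI r) (rO r))) (fst bnd) c))}
     else {Inl c})"

definition res :: "(('w + 'v) set, ('f + 'e) set, 'l) hgraph" where
  "res = \<lparr> nodes = (\<lambda>v. {Inr v}) ` nodes (rR r) \<union> (\<lambda>c. {Inl c}) ` (nodes S - fst m ` nodes (rL r)),
     edges = (\<lambda>e. {Inl e}) ` edges compl \<union> (\<lambda>e. {Inr e}) ` edges (rR r),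
     src = (\<lambda>E. case the_elem E of Inl e \<Rightarrow> map to_res (src S e) | Inr e \<Rightarrow> map (\<lambda>v. {Inr v}) (src (rR r) e)),
     tgt = (\<lambda>E. case the_elem E of Inl e \<Rightarrow> map to_res (tgt S e) | Inr e \<Rightarrow> map (\<lambda>v. {Inr v}) (tgt (rR r) e)),
     lab = (\<lambda>E. case the_elem E of Inl e \<Rightarrow> lab S e | Inr e \<Rightarrow> lab (rR r) e) \<rparr>"

lemma compl_simps [simp]:
  "edges compl = edges S - snd m ` edges (rL r)" "src compl = src S" "tgt compl = tgt S" "lab compl = lab S"
  by (simp_all add: compl_def)

lemma res_simps [simp]:
  "nodes res = (\<lambda>v. {Inr v}) ` nodes (rR r) \<union> (\<lambda>c. {Inl c}) ` (nodes S - fst m ` nodes (rL r))"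
  "edges res = (\<lambda>e. {Inl e}) ` edges compl \<union> (\<lambda>e. {Inr e}) ` edges (rR r)"
  "src res {Inl e} = map to_res (src S e)" "src res {Inr e'} = map (\<lambda>v. {Inr v}) (src (rR r) e')"
  "tgt res {Inl e} = map to_res (tgt S e)" "tgt res {Inr e'} = map (\<lambda>v. {Inr v}) (tgt (rR r) e')"
  "lab res {Inl e} = lab S e" "lab res {Inr e'} = lab (rR r) e'"
  by (simp_all add: res_def)

lemma K_nodes:
  "x \<in> nodes (rI r) \<Longrightarrow> fst (iL r) x \<in> ins (rL r)" "y \<in> nodes (rO r) \<Longrightarrow> fst (oL r) y \<in> outs (rL r)"
  "x \<in> nodes (rI r) \<Longrightarrow> fst (iR r) x \<in> ins (rR r)" "y \<in> nodes (rO r) \<Longrightarrow> fst (oR r) y \<in> outs (rR r)"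
  by (simp_all flip: image_K)

lemma m_eq_iff: "u \<in> nodes (rL r) \<Longrightarrow> v \<in> nodes (rL r) \<Longrightarrow> fst m u = fst m v \<longleftrightarrow> u = v"
  by (rule inj_on_eq_iff[OF inj_nodes])

lemma bnd_simps [simp]: "fst bnd (Inl x) = fst m (fst (iL r) x)" "fst bnd (Inr y) = fst m (fst (oL r) y)"
  by (simp_all add: bnd_def)

lemma inj_bnd: "inj_on (fst bnd) (nodes (hsum (rI r) (rO r)))"
proof -
  have "inj_on (fst (copair (iL r) (oL r))) (nodes (hsum (rI r) (rO r)))"
    using rule by (simp add: left_connected_rule_def hmono_def)
  moreover have "fst (copair (iL r) (oL r)) ` nodes (hsum (rI r) (rO r)) \<subseteq> nodes (rL r)"
    by (auto simp: ins_outs_nodes K_nodes)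
  ultimately have "inj_on (fst m \<circ> fst (copair (iL r) (oL r))) (nodes (hsum (rI r) (rO r)))"
    by (intro comp_inj_on inj_on_subset[OF inj_nodes])
  then show ?thesis by (simp add: bnd_def hcomp_def)
qed

lemma image_bnd: "fst bnd ` nodes (hsum (rI r) (rO r)) = fst m ` ins (rL r) \<union> fst m ` outs (rL r)"
  by (simp add: image_Un image_image flip: image_K)

lemma to_res_simps:
  "x \<in> nodes (rI r) \<Longrightarrow> to_res (fst m (fst (iL r) x)) = {Inr (fst (iR r) x)}"
  "y \<in> nodes (rO r) \<Longrightarrow> to_res (fst m (fst (oL r) y)) = {Inr (fst (oR r) y)}"
  "c \<notin> fst m ` nodes (rL r) \<Longrightarrow> to_res c = {Inl c}"
proof -
  have *: "to_res (fst bnd z) = {Inr (fst (copair (iR r) (oR r)) z)}" if "z \<in> nodes (hsum (rI r) (rO r))" for z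
    unfolding to_res_def using that by (simp only: imageI inv_into_f_f[OF inj_bnd] if_True)
  show "x \<in> nodes (rI r) \<Longrightarrow> to_res (fst m (fst (iL r) x)) = {Inr (fst (iR r) x)}"
    "y \<in> nodes (rO r) \<Longrightarrow> to_res (fst m (fst (oL r) y)) = {Inr (fst (oR r) y)}"
    using *[of "Inl x"] *[of "Inr y"] by auto
  show "c \<notin> fst m ` nodes (rL r) \<Longrightarrow> to_res c = {Inl c}"
    unfolding to_res_def image_bnd by (auto dest: ins_outs_nodes)
qed

lemma compl_node_cases:
  assumes "c \<in> nodes compl"
  obtains (inp) x where "x \<in> nodes (rI r)" "c = fst m (fst (iL r) x)"
  | (outp) y where "y \<in> nodes (rO r)" "c = fst m (fst (oL r) y)"
  | (off) "c \<in> nodes S" "c \<notin> fst m ` nodes (rL r)"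
proof (cases "c \<in> fst m ` nodes (rL r)")
  case True
  then have "c \<in> fst m ` ins (rL r) \<union> fst m ` outs (rL r)" using assms by (auto simp: compl_def)
  then show ?thesis using inp outp unfolding image_K[symmetric] by blast
next
  case False
  then show ?thesis using assms off by (auto simp: compl_def)
qed

lemma K_node_in_compl:
  "x \<in> nodes (rI r) \<Longrightarrow> fst m (fst (iL r) x) \<in> nodes compl"
  "y \<in> nodes (rO r) \<Longrightarrow> fst m (fst (oL r) y) \<in> nodes compl"
  by (auto simp: compl_def is_homD(1)[OF hom] ins_outs_nodes K_nodes m_eq_iff)

text \<open>An unmatched edge can end in the match only at an input, since every other matched node
  has its incoming edge inside the match.\<close>

lemma compl_tgt_cases:
  assumes "e \<in> edges compl" "c \<in> set (tgt S e)"
  obtains (inp) x where "x \<in> nodes (rI r)" "c = fst m (fst (iL r) x)"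
  | (off) "c \<in> nodes S" "c \<notin> fst m ` nodes (rL r)"
proof (cases "c \<in> fst m ` nodes (rL r)")
  case True
  then have "c \<in> fst m ` ins (rL r)" using assms tgt_in_match by auto
  then show ?thesis using inp unfolding image_K[symmetric] by blast
next
  case False
  then show ?thesis using assms off wf_hgraphD(4)[OF wfS] by auto
qed

lemma compl_src_cases:
  assumes "e \<in> edges compl" "c \<in> set (src S e)"
  obtains (outp) y where "y \<in> nodes (rO r)" "c = fst m (fst (oL r) y)"
  | (off) "c \<in> nodes S" "c \<notin> fst m ` nodes (rL r)"
proof (cases "c \<in> fst m ` nodes (rL r)")
  case True
  then have "c \<in> fst m ` outs (rL r)" using assms src_in_match by auto
  then show ?thesis using outp unfolding image_K[symmetric] by blast
next
  case False
  then show ?thesis using assms off wf_hgraphD(3)[OF wfS] by auto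
qed

lemma off_in_compl: "c \<in> nodes S \<Longrightarrow> c \<notin> fst m ` nodes (rL r) \<Longrightarrow> c \<in> nodes compl"
  by (auto simp: compl_def)

lemma wf_compl: "wf_hgraph Sig compl"
proof -
  have "c \<in> nodes compl" if "e \<in> edges compl" "c \<in> set (src S e)" for e c
    using that by (cases rule: compl_src_cases) (auto intro: K_node_in_compl off_in_compl)
  moreover have "c \<in> nodes compl" if "e \<in> edges compl" "c \<in> set (tgt S e)" for e c
    using that by (cases rule: compl_tgt_cases) (auto intro: K_node_in_compl off_in_compl)
  moreover have "finite (nodes compl)" using wf_hgraphD(1)[OF wfS] by (simp add: compl_def)
  ultimately show ?thesis using wfS by (auto simp: wf_hgraph_def)
qed

section \<open>The two pushout squares of the derivation\<close>

lemma hom_bnd: "is_hom (hsum (rI r) (rO r)) compl bnd"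
  using K_node_in_compl by (auto simp: is_hom_def edges_K)

lemma hom_compl: "is_hom compl S (id, id)"
  by (auto simp: is_hom_def compl_def)

lemma pushout_left:
  "is_pushout (hsum (rI r) (rO r)) (rL r) compl S (copair (iL r) (oL r)) bnd m (id, id)"
proof (rule pushout_discreteI)
  show "is_hom (hsum (rI r) (rO r)) (rL r) (copair (iL r) (oL r))"
    using hom_K by (simp add: is_hom_copair)
  show "fst m ` nodes (rL r) \<union> fst (id, id) ` nodes compl = nodes S"
    using is_homD(1)[OF hom] by (auto simp: compl_def)
  show "snd m ` edges (rL r) \<union> snd (id, id) ` edges compl = edges S"
    using is_homD(2)[OF hom] by auto
  show "\<exists>a\<in>nodes (hsum (rI r) (rO r)). fst (copair (iL r) (oL r)) a = b \<and> fst bnd a = c"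
    if b: "b \<in> nodes (rL r)" and c: "c \<in> nodes compl" and eq: "fst m b = fst (id, id) c" for b c
    using c
  proof (cases rule: compl_node_cases)
    case (inp x)
    then have "fst (iL r) x = b" using b eq by (intro inj_onD[OF inj_nodes]) (auto simp: K_nodes ins_outs_nodes)
    then show ?thesis using inp by (intro bexI[of _ "Inl x"]) auto
  next
    case (outp y)
    then have "fst (oL r) y = b" using b eq by (intro inj_onD[OF inj_nodes]) (auto simp: K_nodes ins_outs_nodes)
    then show ?thesis using outp by (intro bexI[of _ "Inr y"]) auto
  next
    case off
    then show ?thesis using b eq by auto
  qed
qed (use hom hom_bnd hom_compl inj_nodes inj_edges in \<open>auto simp: heq_def edges_K bnd_def\<close>)

lemma to_res_node: "c \<in> nodes compl \<Longrightarrow> to_res c \<in> nodes res"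
  by (erule compl_node_cases) (auto simp: to_res_simps K_nodes ins_outs_nodes)

lemma wf_res: "wf_hgraph Sig res"
proof -
  have "finite (nodes res)" "finite (edges res)"
    using wf_hgraphD(1,2)[OF wfS] wf_hgraphD(1,2)[OF wfR] by simp_all
  moreover have "set (src res E) \<subseteq> nodes res \<and> set (tgt res E) \<subseteq> nodes res \<and>
    lab res E \<in> Sig \<and> snd (lab res E) = (length (src res E), length (tgt res E))" if "E \<in> edges res" for E
  proof -
    from that consider (C) e where "e \<in> edges compl" "E = {Inl e}" | (R) e where "e \<in> edges (rR r)" "E = {Inr e}"
      by auto
    then show ?thesis
    proof cases
      case C
      then show ?thesis
        using wf_hgraphD(3-6)[OF wf_compl C(1)] to_res_node by (auto simp del: res_simps(1))
    next
      case R
      then show ?thesis using wf_hgraphD(3-6)[OF wfR R(1)] by auto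
    qed
  qed
  ultimately show ?thesis by (auto simp: wf_hgraph_def simp del: res_simps)
qed

lemma hom_to_res: "is_hom compl res (to_res, \<lambda>e. {Inl e})"
  using to_res_node by (auto simp: is_hom_def simp del: res_simps(1))

lemma hom_R_res: "is_hom (rR r) res (\<lambda>v. {Inr v}, \<lambda>e. {Inr e})"
  by (auto simp: is_hom_def)

lemma pushout_right:
  "is_pushout (hsum (rI r) (rO r)) (rR r) compl res (copair (iR r) (oR r)) bnd
     (\<lambda>v. {Inr v}, \<lambda>e. {Inr e}) (to_res, \<lambda>e. {Inl e})"
proof (rule pushout_discreteI)
  have K: "\<exists>a\<in>nodes (hsum (rI r) (rO r)). fst (copair (iR r) (oR r)) a = b \<and> fst bnd a = c"
    if "c \<in> nodes compl" "to_res c = {Inr b}" for b c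
    using that(1)
  proof (cases rule: compl_node_cases)
    case (inp x)
    then show ?thesis using that(2) by (intro bexI[of _ "Inl x"]) (auto simp: to_res_simps)
  next
    case (outp y)
    then show ?thesis using that(2) by (intro bexI[of _ "Inr y"]) (auto simp: to_res_simps)
  next
    case off
    then show ?thesis using that(2) by (auto simp: to_res_simps)
  qed
  show "\<exists>a\<in>nodes (hsum (rI r) (rO r)). fst (copair (iR r) (oR r)) a = b \<and> fst bnd a = c"
    if "b \<in> nodes (rR r)" "c \<in> nodes compl"
      "fst (\<lambda>v. {Inr v}, \<lambda>e. {Inr e}) b = fst (to_res, \<lambda>e. {Inl e}) c" for b c
    using K that by simp
  show "\<exists>a\<in>nodes (hsum (rI r) (rO r)). \<exists>a'\<in>nodes (hsum (rI r) (rO r)).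
      fst bnd a = c \<and> fst bnd a' = c' \<and> fst (copair (iR r) (oR r)) a = fst (copair (iR r) (oR r)) a'"
    if c: "c \<in> nodes compl" "c' \<in> nodes compl" and
      eq: "fst (to_res, \<lambda>e. {Inl e}) c = fst (to_res, \<lambda>e. {Inl e}) c'" and "c \<noteq> c'" for c c'
  proof -
    obtain b where b: "to_res c = {Inr b} \<or> to_res c = {Inl c} \<and> c \<notin> fst m ` nodes (rL r)"
      using c(1) by (cases rule: compl_node_cases) (auto simp: to_res_simps)
    obtain b' where b': "to_res c' = {Inr b'} \<or> to_res c' = {Inl c'} \<and> c' \<notin> fst m ` nodes (rL r)"
      using c(2) by (cases rule: compl_node_cases) (auto simp: to_res_simps)
    \<comment> \<open>The value \<open>{Inl c}\<close> determines \<open>c\<close>, so distinct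
      nodes with the same value both lie on the boundary and are sent to one node of the right-hand
      side.\<close>
    have "to_res c = {Inr b}" "to_res c' = {Inr b}" using b b' eq \<open>c \<noteq> c'\<close> by auto
    then obtain a a' where "a \<in> nodes (hsum (rI r) (rO r))" "fst (copair (iR r) (oR r)) a = b" "fst bnd a = c"
      "a' \<in> nodes (hsum (rI r) (rO r))" "fst (copair (iR r) (oR r)) a' = b" "fst bnd a' = c'"
      using K[OF c(1), of b] K[OF c(2), of b] by meson
    then show ?thesis by (intro bexI[of _ a] bexI[of _ a'] conjI) simp_all
  qed
  show "fst (\<lambda>v. {Inr v}, \<lambda>e. {Inr e}) ` nodes (rR r) \<union> fst (to_res, \<lambda>e. {Inl e}) ` nodes compl = nodes res"
  proof
    show "fst (\<lambda>v. {Inr v}, \<lambda>e. {Inr e}) ` nodes (rR r) \<union> fst (to_res, \<lambda>e. {Inl e}) ` nodes compl \<subseteq> nodes res"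
      using to_res_node by auto
    show "nodes res \<subseteq> fst (\<lambda>v. {Inr v}, \<lambda>e. {Inr e}) ` nodes (rR r) \<union> fst (to_res, \<lambda>e. {Inl e}) ` nodes compl"
    proof -
      have "{Inl c} \<in> to_res ` nodes compl" if "c \<in> nodes S" "c \<notin> fst m ` nodes (rL r)" for c
        unfolding to_res_simps(3)[OF that(2), symmetric] by (rule imageI[OF off_in_compl[OF that]])
      then show ?thesis by auto
    qed
  qed
  show "heq (hsum (rI r) (rO r)) (hcomp (copair (iR r) (oR r)) (\<lambda>v. {Inr v}, \<lambda>e. {Inr e}))
     (hcomp bnd (to_res, \<lambda>e. {Inl e}))"
    by (auto simp: heq_def edges_K to_res_simps)
qed (use hom_K hom_bnd hom_to_res hom_R_res in \<open>auto simp: is_hom_copair edges_K inj_on_def\<close>)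

text \<open>Only pairs consisting of an input and an output can be identified in the right-hand side.\<close>

lemma inj_to_res:
  "inj_on to_res (nodes compl - fst m ` outs (rL r))" "inj_on to_res (nodes compl - fst m ` ins (rL r))"
proof -
  show "inj_on to_res (nodes compl - fst m ` outs (rL r))"
  proof (rule inj_onI)
    fix c d assume c: "c \<in> nodes compl - fst m ` outs (rL r)" and d: "d \<in> nodes compl - fst m ` outs (rL r)"
      and eq: "to_res c = to_res d"
    have "(\<exists>x\<in>nodes (rI r). c = fst m (fst (iL r) x)) \<or> c \<notin> fst m ` nodes (rL r)"
      "(\<exists>x\<in>nodes (rI r). d = fst m (fst (iL r) x)) \<or> d \<notin> fst m ` nodes (rL r)"
      using c d K_nodes(2) by (blast elim: compl_node_cases)+
    then show "c = d" using eq inj_K(3) by (auto simp: to_res_simps dest: inj_onD)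
  qed
  show "inj_on to_res (nodes compl - fst m ` ins (rL r))"
  proof (rule inj_onI)
    fix c d assume c: "c \<in> nodes compl - fst m ` ins (rL r)" and d: "d \<in> nodes compl - fst m ` ins (rL r)"
      and eq: "to_res c = to_res d"
    have "(\<exists>x\<in>nodes (rO r). c = fst m (fst (oL r) x)) \<or> c \<notin> fst m ` nodes (rL r)"
      "(\<exists>x\<in>nodes (rO r). d = fst m (fst (oL r) x)) \<or> d \<notin> fst m ` nodes (rL r)"
      using c d K_nodes(1) by (blast elim: compl_node_cases)+
    then show "c = d" using eq inj_K(4) by (auto simp: to_res_simps dest: inj_onD)
  qed
qed

text \<open>Targets of unmatched edges fall into the first domain of \<open>inj_to_res\<close>, so
  \<open>to_res\<close> never merges two of them.\<close>

lemma compl_tgt: "e \<in> edges compl \<Longrightarrow> c \<in> set (tgt S e) \<Longrightarrow> c \<in> nodes compl - fst m ` outs (rL r)"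
  by (erule (1) compl_tgt_cases)
    (auto simp: K_node_in_compl outs_ins_distinct K_nodes off_in_compl ins_outs_nodes)

lemma compl_src: "e \<in> edges compl \<Longrightarrow> c \<in> set (src S e) \<Longrightarrow> c \<in> nodes compl - fst m ` ins (rL r)"
  by (erule (1) compl_src_cases)
    (auto simp: K_node_in_compl outs_ins_distinct[symmetric] K_nodes off_in_compl ins_outs_nodes)

text \<open>An edge of the left-hand side into \<open>u\<close> would be carried to an edge into
  \<open>c\<close>. So an input of \<open>S\<close> covered by the match comes from an input of the
  rule, which is never an output.\<close>

lemma ins_S_compl: "c \<in> ins S \<Longrightarrow> c \<in> nodes compl - fst m ` outs (rL r)"
proof -
  assume c: "c \<in> ins S"
  have *: "u \<in> ins (rL r)" if u: "u \<in> nodes (rL r)" "c = fst m u" for u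
    unfolding ins_iff[OF wfL]
  proof (intro conjI u(1) ballI notI)
    fix e assume "e \<in> edges (rL r)" "u \<in> set (tgt (rL r) e)"
    then have "snd m e \<in> edges S" "c \<in> set (tgt S (snd m e))" using u by (auto simp: is_homD[OF hom])
    then show False using c by (auto simp: ins_iff[OF wfS])
  qed
  then have "c \<notin> fst m ` outs (rL r)" using *[OF ins_outs_nodes(2)] ins_outs_disjoint by blast
  moreover have "c \<in> nodes compl" using c * by (auto simp: compl_def ins_outs_nodes)
  ultimately show ?thesis by blast
qed

lemma outs_S_compl: "c \<in> outs S \<Longrightarrow> c \<in> nodes compl - fst m ` ins (rL r)"
proof -
  assume c: "c \<in> outs S"
  have *: "u \<in> outs (rL r)" if u: "u \<in> nodes (rL r)" "c = fst m u" for u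
    unfolding outs_iff[OF wfL]
  proof (intro conjI u(1) ballI notI)
    fix e assume "e \<in> edges (rL r)" "u \<in> set (src (rL r) e)"
    then have "snd m e \<in> edges S" "c \<in> set (src S (snd m e))" using u by (auto simp: is_homD[OF hom])
    then show False using c by (auto simp: outs_iff[OF wfS])
  qed
  then have "c \<notin> fst m ` ins (rL r)" using *[OF ins_outs_nodes(1)] ins_outs_disjoint by blast
  moreover have "c \<in> nodes compl" using c * by (auto simp: compl_def ins_outs_nodes)
  ultimately show ?thesis by blast
qed

section \<open>Monogamy and acyclicity of the result\<close>

lemma to_res_tgt_eq_Inr:
  assumes "e \<in> edges compl" "c \<in> set (tgt S e)" "to_res c = {Inr v}"
  obtains x where "x \<in> nodes (rI r)" "c = fst m (fst (iL r) x)" "v = fst (iR r) x"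
  using assms(1,2) by (rule compl_tgt_cases) (use assms(3) that in \<open>auto simp: to_res_simps\<close>)

lemma to_res_src_eq_Inr:
  assumes "e \<in> edges compl" "c \<in> set (src S e)" "to_res c = {Inr v}"
  obtains y where "y \<in> nodes (rO r)" "c = fst m (fst (oL r) y)" "v = fst (oR r) y"
  using assms(1,2) by (rule compl_src_cases) (use assms(3) that in \<open>auto simp: to_res_simps\<close>)

text \<open>Unmatched edges end in the right-hand side only at its inputs, where none of its own
  edges ends, so edges of different origin share no target. Among unmatched edges
  \<open>to_res\<close> is injective on targets and monogamy of \<open>S\<close> applies; among the
  others, that of the right-hand side.\<close>

lemma res_tgt_unique:
  assumes "E \<in> edges res" "E' \<in> edges res" "i < length (tgt res E)" "j < length (tgt res E')"
    "tgt res E ! i = tgt res E' ! j"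
  shows "E = E' \<and> i = j"
proof -
  have cr: False if "e \<in> edges compl" "f \<in> edges (rR r)" "c \<in> set (tgt S e)" "v \<in> set (tgt (rR r) f)"
    "to_res c = {Inr v}" for e f c v
    using to_res_tgt_eq_Inr[OF that(1,3,5)] K_nodes(3) that(2,4) by (metis ins_iff[OF wfR])
  have cc: "e = e' \<and> i = j" if e: "e \<in> edges compl" "e' \<in> edges compl" and
    ij: "i < length (tgt S e)" "j < length (tgt S e')" "to_res (tgt S e ! i) = to_res (tgt S e' ! j)" for e e'
  proof -
    have "tgt S e ! i = tgt S e' ! j"
      using inj_onD[OF inj_to_res(1) ij(3) compl_tgt[OF e(1) nth_mem[OF ij(1)]] compl_tgt[OF e(2) nth_mem[OF ij(2)]]] .
    then show ?thesis using e ij by (intro mon_acyclicD(2)[OF maS wfS]) auto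
  qed
  have rr: "e = e' \<and> i = j" if "e \<in> edges (rR r)" "e' \<in> edges (rR r)"
    "i < length (tgt (rR r) e)" "j < length (tgt (rR r) e')" "tgt (rR r) e ! i = tgt (rR r) e' ! j" for e e'
    using mon_acyclicD(2)[OF maR wfR that] .
  consider (CC) e e' where "e \<in> edges compl" "e' \<in> edges compl" "E = {Inl e}" "E' = {Inl e'}"
    | (CR) e e' where "e \<in> edges compl" "e' \<in> edges (rR r)" "E = {Inl e}" "E' = {Inr e'}"
    | (RC) e e' where "e \<in> edges (rR r)" "e' \<in> edges compl" "E = {Inr e}" "E' = {Inl e'}"
    | (RR) e e' where "e \<in> edges (rR r)" "e' \<in> edges (rR r)" "E = {Inr e}" "E' = {Inr e'}"
    using assms(1,2) unfolding res_simps by blast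
  then show ?thesis
  proof cases
    case (CC e e')
    then show ?thesis using cc[of e e'] assms(3-5) by simp
  next
    case (CR e e')
    then show ?thesis using cr[of e e' "tgt S e ! i" "tgt (rR r) e' ! j"] assms(3-5) by simp
  next
    case (RC e e')
    then show ?thesis using cr[of e' e "tgt S e' ! j" "tgt (rR r) e ! i"] assms(3-5) by simp
  next
    case (RR e e')
    then show ?thesis using rr[of e e'] assms(3-5) by simp
  qed
qed

lemma res_src_unique:
  assumes "E \<in> edges res" "E' \<in> edges res" "i < length (src res E)" "j < length (src res E')"
    "src res E ! i = src res E' ! j"
  shows "E = E' \<and> i = j"
proof -
  have cr: False if "e \<in> edges compl" "f \<in> edges (rR r)" "c \<in> set (src S e)" "v \<in> set (src (rR r) f)"
    "to_res c = {Inr v}" for e f c v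
    using to_res_src_eq_Inr[OF that(1,3,5)] K_nodes(4) that(2,4) by (metis outs_iff[OF wfR])
  have cc: "e = e' \<and> i = j" if e: "e \<in> edges compl" "e' \<in> edges compl" and
    ij: "i < length (src S e)" "j < length (src S e')" "to_res (src S e ! i) = to_res (src S e' ! j)" for e e'
  proof -
    have "src S e ! i = src S e' ! j"
      using inj_onD[OF inj_to_res(2) ij(3) compl_src[OF e(1) nth_mem[OF ij(1)]] compl_src[OF e(2) nth_mem[OF ij(2)]]] .
    then show ?thesis using e ij by (intro mon_acyclicD(3)[OF maS wfS]) auto
  qed
  have rr: "e = e' \<and> i = j" if "e \<in> edges (rR r)" "e' \<in> edges (rR r)"
    "i < length (src (rR r) e)" "j < length (src (rR r) e')" "src (rR r) e ! i = src (rR r) e' ! j" for e e'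
    using mon_acyclicD(3)[OF maR wfR that] .
  consider (CC) e e' where "e \<in> edges compl" "e' \<in> edges compl" "E = {Inl e}" "E' = {Inl e'}"
    | (CR) e e' where "e \<in> edges compl" "e' \<in> edges (rR r)" "E = {Inl e}" "E' = {Inr e'}"
    | (RC) e e' where "e \<in> edges (rR r)" "e' \<in> edges compl" "E = {Inr e}" "E' = {Inl e'}"
    | (RR) e e' where "e \<in> edges (rR r)" "e' \<in> edges (rR r)" "E = {Inr e}" "E' = {Inr e'}"
    using assms(1,2) unfolding res_simps by blast
  then show ?thesis
  proof cases
    case (CC e e')
    then show ?thesis using cc[of e e'] assms(3-5) by simp
  next
    case (CR e e')
    then show ?thesis using cr[of e e' "src S e ! i" "src (rR r) e' ! j"] assms(3-5) by simp
  next
    case (RC e e')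
    then show ?thesis using cr[of e' e "src S e' ! j" "src (rR r) e ! i"] assms(3-5) by simp
  next
    case (RR e e')
    then show ?thesis using rr[of e e'] assms(3-5) by simp
  qed
qed

text \<open>Every edge of the result sits at level 0 (complement edges not reachable from an output of
  the match), 1 (edges of R) or 2 (complement edges reachable from an output). Adjacency never lowers
  the level, because no path returns from an output to an input, and within a level it is
  inherited from S or from R.\<close>

lemma acyclic_res: "acyclic (adj res)"
proof -
  define A where "A = {e. \<exists>y\<in>outs (rL r). \<exists>d\<in>edges S. fst m y \<in> set (src S d) \<and> (d, e) \<in> (adj S)\<^sup>*}"
  \<comment> \<open>The first \<open>undefined\<close> makes the middle components of any two edges
    of the right-hand side equal, so that the lexicographic comparison passes on to
    \<open>adj (rR r)\<close>. On complement edges of equal level \<open>adj S\<close> decides, and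
    the last component is a filler.\<close>
  define rank :: "('f + 'e) set \<Rightarrow> nat \<times> 'f \<times> 'e" where
    "rank E = (case the_elem E of Inl e \<Rightarrow> (if e \<in> A then 2 else 0, e, undefined)
                                | Inr e \<Rightarrow> (1, undefined, e))" for E
  have inA: "e \<in> A" if "e \<in> edges compl" "y \<in> nodes (rO r)" "fst m (fst (oL r) y) \<in> set (src S e)" for e y
    unfolding A_def using that K_nodes(2) by auto
  have notA: "e \<notin> A" if "e \<in> edges compl" "x \<in> nodes (rI r)" "fst m (fst (iL r) x) \<in> set (tgt S e)" for e x
    unfolding A_def using that no_return[OF K_nodes(1)[OF that(2)]] by auto
  have stepA: "e' \<in> A" if "e \<in> A" "(e, e') \<in> adj S" for e e'
    using that unfolding A_def by (auto intro: rtrancl_into_rtrancl)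
  have "wf (less_than <*lex*> adj S <*lex*> adj (rR r))"
    by (intro wf_lex_prod wf_less_than finite_acyclic_wf finite_adj wf_hgraphD(2)[OF wfS] wf_hgraphD(2)[OF wfR]
        mon_acyclicD(1)[OF maS wfS] mon_acyclicD(1)[OF maR wfR])
  then have "wf (inv_image (less_than <*lex*> adj S <*lex*> adj (rR r)) rank)" (is "wf ?W")
    by (rule wf_inv_image)
  moreover have "adj res \<subseteq> ?W"
  proof (rule subrelI)
    fix E E' assume EE: "(E, E') \<in> adj res"
    then obtain w where E: "E \<in> edges res" "E' \<in> edges res" and w: "w \<in> set (tgt res E)" "w \<in> set (src res E')"
      by (auto simp: adj_def simp del: res_simps)
    consider (CC) e e' where "e \<in> edges compl" "e' \<in> edges compl" "E = {Inl e}" "E' = {Inl e'}"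
      | (CR) e e' where "e \<in> edges compl" "e' \<in> edges (rR r)" "E = {Inl e}" "E' = {Inr e'}"
      | (RC) e e' where "e \<in> edges (rR r)" "e' \<in> edges compl" "E = {Inr e}" "E' = {Inl e'}"
      | (RR) e e' where "e \<in> edges (rR r)" "e' \<in> edges (rR r)" "E = {Inr e}" "E' = {Inr e'}"
      using E unfolding res_simps by blast
    then show "(E, E') \<in> ?W"
    proof cases
      case (CC e e')
      obtain c c' where c: "c \<in> set (tgt S e)" "c' \<in> set (src S e')" "to_res c = w" "to_res c' = w"
        using w CC by auto
      show ?thesis
        using CC(1) c(1)
      proof (cases rule: compl_tgt_cases)
        \<comment> \<open>The connecting node is an input merged with an output of the right-hand
          side: the step goes from level 0 straight to level 2.\<close>
        case (inp x)
        then have "to_res c' = {Inr (fst (iR r) x)}" using c by (simp add: to_res_simps)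
        then obtain y where "y \<in> nodes (rO r)" "c' = fst m (fst (oL r) y)"
          using to_res_src_eq_Inr[OF CC(2) c(2)] by blast
        then have "e' \<in> A" using inA[OF CC(2)] c(2) by blast
        moreover have "e \<notin> A" using notA[OF CC(1)] c(1) inp by blast
        ultimately show ?thesis using CC(3,4) by (simp add: rank_def)
      next
        case off
        have "c' = c" using CC(2) c(2)
          by (rule compl_src_cases) (use c(3,4) off in \<open>auto simp: to_res_simps\<close>)
        then have "(e, e') \<in> adj S" using c CC by (auto simp: adj_def)
        then show ?thesis using stepA CC(3,4) by (auto simp: rank_def)
      qed
    next
      case (CR e e')
      obtain c v where "c \<in> set (tgt S e)" "to_res c = {Inr v}" using w CR by auto
      then have "e \<notin> A" using to_res_tgt_eq_Inr[OF CR(1)] notA[OF CR(1)] by metis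
      then show ?thesis using CR(3,4) by (simp add: rank_def)
    next
      case (RC e e')
      obtain c v where "c \<in> set (src S e')" "to_res c = {Inr v}" using w RC by auto
      then have "e' \<in> A" using to_res_src_eq_Inr[OF RC(2)] inA[OF RC(2)] by metis
      then show ?thesis using RC(3,4) by (simp add: rank_def)
    next
      case (RR e e')
      then have "(e, e') \<in> adj (rR r)" using w by (auto simp: adj_def)
      then show ?thesis using RR(3,4) by (simp add: rank_def)
    qed
  qed
  ultimately show ?thesis by (auto intro: wf_acyclic wf_subset)
qed

lemma mon_acyclic_res: "mon_acyclic res"
  unfolding mon_acyclic_iff[OF wf_res]
  by (intro conjI[OF acyclic_res conjI] ballI allI impI; rule res_tgt_unique res_src_unique; assumption)

section \<open>Inputs and outputs of the result\<close>

lemma res_degree_0_iff: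
  "(\<forall>E\<in>edges res. w \<notin> set (tgt res E)) \<longleftrightarrow>
   (\<forall>e\<in>edges compl. w \<notin> to_res ` set (tgt S e)) \<and> (\<forall>e\<in>edges (rR r). w \<notin> (\<lambda>v. {Inr v}) ` set (tgt (rR r) e))"
  "(\<forall>E\<in>edges res. w \<notin> set (src res E)) \<longleftrightarrow>
   (\<forall>e\<in>edges compl. w \<notin> to_res ` set (src S e)) \<and> (\<forall>e\<in>edges (rR r). w \<notin> (\<lambda>v. {Inr v}) ` set (src (rR r) e))"
  by (simp_all add: ball_Un del: compl_simps)

lemma ins_res: "to_res ` ins S = ins res"
proof (intro equalityI subsetI)
  fix w assume "w \<in> to_res ` ins S"
  then obtain c where c: "c \<in> ins S" "w = to_res c" by blast
  note cC = ins_S_compl[OF c(1)]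
  have "w \<notin> to_res ` set (tgt S e)" if e: "e \<in> edges compl" for e
  proof
    assume "w \<in> to_res ` set (tgt S e)"
    then obtain d where d: "d \<in> set (tgt S e)" "to_res c = to_res d" using c by auto
    have "c = d" using inj_onD[OF inj_to_res(1) d(2) cC compl_tgt[OF e d(1)]] .
    then show False using c(1) d(1) e by (auto simp: ins_iff[OF wfS])
  qed
  moreover have "w \<notin> (\<lambda>v. {Inr v}) ` set (tgt (rR r) e)" if e: "e \<in> edges (rR r)" for e
  proof
    assume "w \<in> (\<lambda>v. {Inr v}) ` set (tgt (rR r) e)"
    then obtain v where v: "v \<in> set (tgt (rR r) e)" "to_res c = {Inr v}" using c by auto
    have "c \<in> nodes compl" using cC by simp
    then have "v \<in> ins (rR r)"
      by (cases rule: compl_node_cases) (use v cC K_nodes in \<open>auto simp: to_res_simps\<close>)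
    then show False using v e by (auto simp: ins_iff[OF wfR])
  qed
  ultimately show "w \<in> ins res"
    unfolding ins_iff[OF wf_res] res_degree_0_iff using to_res_node[of c] cC c(2) by auto
next
  fix w assume "w \<in> ins res"
  then have w: "w \<in> nodes res" "\<And>e. e \<in> edges compl \<Longrightarrow> w \<notin> to_res ` set (tgt S e)"
    "\<And>e. e \<in> edges (rR r) \<Longrightarrow> w \<notin> (\<lambda>v. {Inr v}) ` set (tgt (rR r) e)"
    unfolding ins_iff[OF wf_res] res_degree_0_iff by auto
  \<comment> \<open>A node of the right-hand side that is both an input and an output has two
    preimages on the boundary. The one along the input leg is taken, because no matched edge ends
    there.\<close>
  obtain c where c: "c \<in> nodes S" "c \<notin> fst m ` (nodes (rL r) - ins (rL r))" "to_res c = w"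
  proof (cases "\<exists>v\<in>nodes (rR r). w = {Inr v}")
    case True
    then obtain v where v: "v \<in> nodes (rR r)" "w = {Inr v}" by blast
    then have "v \<in> ins (rR r)" using w(3) by (auto simp: ins_iff[OF wfR])
    then obtain x where x: "x \<in> nodes (rI r)" "v = fst (iR r) x" unfolding image_K[symmetric] by blast
    then have "fst m (fst (iL r) x) \<notin> fst m ` (nodes (rL r) - ins (rL r))"
      by (auto simp: m_eq_iff K_nodes ins_outs_nodes)
    then show ?thesis using that[of "fst m (fst (iL r) x)"] x v by (auto simp: to_res_simps K_nodes ins_outs_nodes is_homD(1)[OF hom])
  next
    case False
    then obtain c where "c \<in> nodes S" "c \<notin> fst m ` nodes (rL r)" "w = {Inl c}" using w(1) by auto
    then show ?thesis using that[of c] by (auto simp: to_res_simps)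
  qed
  have "c \<in> ins S"
    unfolding ins_iff[OF wfS]
  proof (intro conjI c(1) ballI notI)
    fix e assume e: "e \<in> edges S" "c \<in> set (tgt S e)"
    show False
    proof (cases "e \<in> snd m ` edges (rL r)")
      case True
      then show False using match_edge_nodes(1) e(2) c(2) by blast
    next
      case False
      then show False using w(2)[of e] e c(3) by auto
    qed
  qed
  then show "w \<in> to_res ` ins S" using c(3) by blast
qed

lemma outs_res: "to_res ` outs S = outs res"
proof (intro equalityI subsetI)
  fix w assume "w \<in> to_res ` outs S"
  then obtain c where c: "c \<in> outs S" "w = to_res c" by blast
  note cC = outs_S_compl[OF c(1)]
  have "w \<notin> to_res ` set (src S e)" if e: "e \<in> edges compl" for e
  proof
    assume "w \<in> to_res ` set (src S e)"
    then obtain d where d: "d \<in> set (src S e)" "to_res c = to_res d" using c by auto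
    have "c = d" using inj_onD[OF inj_to_res(2) d(2) cC compl_src[OF e d(1)]] .
    then show False using c(1) d(1) e by (auto simp: outs_iff[OF wfS])
  qed
  moreover have "w \<notin> (\<lambda>v. {Inr v}) ` set (src (rR r) e)" if e: "e \<in> edges (rR r)" for e
  proof
    assume "w \<in> (\<lambda>v. {Inr v}) ` set (src (rR r) e)"
    then obtain v where v: "v \<in> set (src (rR r) e)" "to_res c = {Inr v}" using c by auto
    have "c \<in> nodes compl" using cC by simp
    then have "v \<in> outs (rR r)"
      by (cases rule: compl_node_cases) (use v cC K_nodes in \<open>auto simp: to_res_simps\<close>)
    then show False using v e by (auto simp: outs_iff[OF wfR])
  qed
  ultimately show "w \<in> outs res"
    unfolding outs_iff[OF wf_res] res_degree_0_iff using to_res_node[of c] cC c(2) by auto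
next
  fix w assume "w \<in> outs res"
  then have w: "w \<in> nodes res" "\<And>e. e \<in> edges compl \<Longrightarrow> w \<notin> to_res ` set (src S e)"
    "\<And>e. e \<in> edges (rR r) \<Longrightarrow> w \<notin> (\<lambda>v. {Inr v}) ` set (src (rR r) e)"
    unfolding outs_iff[OF wf_res] res_degree_0_iff by auto
  \<comment> \<open>Dually, the preimage along the output leg is taken, at which no matched edge
    starts.\<close>
  obtain c where c: "c \<in> nodes S" "c \<notin> fst m ` (nodes (rL r) - outs (rL r))" "to_res c = w"
  proof (cases "\<exists>v\<in>nodes (rR r). w = {Inr v}")
    case True
    then obtain v where v: "v \<in> nodes (rR r)" "w = {Inr v}" by blast
    then have "v \<in> outs (rR r)" using w(3) by (auto simp: outs_iff[OF wfR])
    then obtain x where x: "x \<in> nodes (rO r)" "v = fst (oR r) x" unfolding image_K[symmetric] by blast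
    then have "fst m (fst (oL r) x) \<notin> fst m ` (nodes (rL r) - outs (rL r))"
      by (auto simp: m_eq_iff K_nodes ins_outs_nodes)
    then show ?thesis using that[of "fst m (fst (oL r) x)"] x v by (auto simp: to_res_simps K_nodes ins_outs_nodes is_homD(1)[OF hom])
  next
    case False
    then obtain c where "c \<in> nodes S" "c \<notin> fst m ` nodes (rL r)" "w = {Inl c}" using w(1) by auto
    then show ?thesis using that[of c] by (auto simp: to_res_simps)
  qed
  have "c \<in> outs S"
    unfolding outs_iff[OF wfS]
  proof (intro conjI c(1) ballI notI)
    fix e assume e: "e \<in> edges S" "c \<in> set (src S e)"
    show False
    proof (cases "e \<in> snd m ` edges (rL r)")
      case True
      then show False using match_edge_nodes(2) e(2) c(2) by blast
    next
      case False
      then show False using w(2)[of e] e c(3) by auto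
    qed
  qed
  then show "w \<in> to_res ` outs S" using c(3) by blast
qed

text \<open>The interface legs of the result are \<open>to_res\<close> on inputs and on outputs of
  \<open>S\<close>. They stay injective since inputs of \<open>S\<close> avoid the outputs of the
  match and outputs of \<open>S\<close> avoid its inputs.\<close>

lemma derivation:
  "is_derivation Sig r (discrete (ins S)) S (discrete (outs S)) (id, id) (id, id) m compl bnd (id, id)
     (copair (id, id) (id, id)) res (to_res, \<lambda>e. {Inl e}) (\<lambda>v. {Inr v}, \<lambda>e. {Inr e})"
proof -
  have sub: "ins S \<subseteq> nodes compl - fst m ` outs (rL r)" "outs S \<subseteq> nodes compl - fst m ` ins (rL r)"
    using ins_S_compl outs_S_compl by blast+
  have inj: "inj_on to_res (ins S)" "inj_on to_res (outs S)"
    by (rule inj_on_subset[OF inj_to_res(1) sub(1)], rule inj_on_subset[OF inj_to_res(2) sub(2)])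
  have legs: "hcomp inj1 (hcomp (copair (id, id) (id, id)) (to_res, \<lambda>e. {Inl e})) = (to_res, \<lambda>e. {Inl e})"
    "hcomp inj2 (hcomp (copair (id, id) (id, id)) (to_res, \<lambda>e. {Inl e})) = (to_res, \<lambda>e. {Inl e})"
    by (auto simp: hcomp_def copair_def inj1_def inj2_def)
  have "finite (ins S)" "finite (outs S)"
    using wf_hgraphD(1)[OF wfS] by (simp_all add: ins_def outs_def)
  then have "ma_cospan Sig (discrete (ins S)) res (discrete (outs S))
    (hcomp inj1 (hcomp (copair (id, id) (id, id)) (to_res, \<lambda>e. {Inl e})))
    (hcomp inj2 (hcomp (copair (id, id) (id, id)) (to_res, \<lambda>e. {Inl e})))"
    unfolding legs ma_cospan_def
    using inj wf_res mon_acyclic_res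
    by (simp add: wf_hgraph_def is_hom_def hmono_def ins_res outs_res ins_outs_nodes subset_iff del: res_simps)
  moreover have "is_hom (hsum (discrete (ins S)) (discrete (outs S))) compl (copair (id, id) (id, id))"
    using sub by (auto simp: is_hom_def)
  moreover have "heq (hsum (discrete (ins S)) (discrete (outs S)))
      (hcomp (copair (id, id) (id, id)) (id, id)) (copair (id, id) (id, id))"
    by (auto simp: heq_def)
  ultimately show ?thesis
    unfolding is_derivation_def ma_cospan_discrete_iff
    using wfS maS wf_compl wf_res convex pushout_left pushout_right by blast
qed

end

section \<open>Critical pairs\<close>

text \<open>The definition asks for some pair of derivations that is not parallel, and the canonical
  ones serve: a factorisation of \<open>m1\<close> through the second complement would retain the
  common edge, which has been deleted there.\<close>

lemma critical_pairI:
  assumes "rule_match Sig r1 S m1" "rule_match Sig r2 S m2"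
    and "hepi (hsum (rL r1) (rL r2)) S (copair m1 m2)"
    and ab: "a \<in> edges (rL r1)" "b \<in> edges (rL r2)" "snd m1 a = snd m2 b"
  shows "critical_pair Sig r1 r2 S m1 m2"
proof -
  interpret M1: rule_match Sig r1 S m1 by fact
  interpret M2: rule_match Sig r2 S m2 by fact
  have "\<not> parallel (rL r1) (rL r2) m1 m2 M1.compl (id, id) M2.compl (id, id)"
  proof
    assume "parallel (rL r1) (rL r2) m1 m2 M1.compl (id, id) M2.compl (id, id)"
    then obtain g where g: "is_hom (rL r1) M2.compl g" "heq (rL r1) (hcomp g (id, id)) m1"
      by (auto simp: parallel_def)
    have "snd m1 a \<in> edges M2.compl" using g ab(1) is_homD(2)[OF g(1) ab(1)] by (simp add: heq_def)
    then show False using ab by auto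
  qed
  moreover have "is_hom (hsum (rL r1) (rL r2)) S (copair m1 m2)"
    using M1.hom M2.hom by (simp add: is_hom_copair)
  ultimately show ?thesis
    unfolding critical_pair_def using M1.derivation M2.derivation assms(3) by blast
qed

text \<open>Edges of \<open>X\<close> outside the other match come from \<open>C\<close>, and nodes
  follow because each of them lies on an edge. As the leg \<open>c\<close> of any complement is
  injective, \<open>m\<close> followed by its inverse is the factorisation.\<close>

lemma (in left_connected) factor_through_complement:
  assumes hom: "is_hom (rL r) X m" and po: "is_pushout K L C X f g m' c" and "hmono K f" "wf_hgraph Sig' C"
    and disj: "snd m ` edges (rL r) \<inter> snd m' ` edges L = {}"
  shows "\<exists>h. is_hom (rL r) C h \<and> heq (rL r) (hcomp h c) m"
proof -
  have homc: "is_hom C X c" using po by (simp add: is_pushout_def)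
  have inj: "inj_on (fst c) (nodes C)" "inj_on (snd c) (edges C)"
    using pushout_hmono[OF po \<open>hmono K f\<close>] by (auto simp: hmono_def)
  note wfC = wf_hgraphD[OF \<open>wf_hgraph Sig' C\<close>]
  have E: "snd m e \<in> snd c ` edges C" if "e \<in> edges (rL r)" for e
    using is_homD(2)[OF hom that] disj that unfolding pushout_hepi(2)[OF po] by blast
  have V: "fst m v \<in> fst c ` nodes C" if "v \<in> nodes (rL r)" for v
    using in_or_out_edge[OF that]
  proof (elim disjE bexE)
    fix e assume e: "e \<in> edges (rL r)" "v \<in> set (src (rL r) e)"
    obtain d where d: "d \<in> edges C" "snd m e = snd c d" using E[OF e(1)] by blast
    have "fst m v \<in> set (src X (snd m e))" using e by (simp add: is_homD[OF hom])
    then show ?thesis using d wfC(3)[OF d(1)] by (auto simp: is_homD[OF homc])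
  next
    fix e assume e: "e \<in> edges (rL r)" "v \<in> set (tgt (rL r) e)"
    obtain d where d: "d \<in> edges C" "snd m e = snd c d" using E[OF e(1)] by blast
    have "fst m v \<in> set (tgt X (snd m e))" using e by (simp add: is_homD[OF hom])
    then show ?thesis using d wfC(4)[OF d(1)] by (auto simp: is_homD[OF homc])
  qed
  define h where "h = (\<lambda>v. inv_into (nodes C) (fst c) (fst m v), \<lambda>e. inv_into (edges C) (snd c) (snd m e))"
  have hV: "fst h v \<in> nodes C" "fst c (fst h v) = fst m v" if "v \<in> nodes (rL r)" for v
    using inv_into_into[OF V[OF that]] f_inv_into_f[OF V[OF that]] by (simp_all add: h_def)
  have hE: "snd h e \<in> edges C" "snd c (snd h e) = snd m e" if "e \<in> edges (rL r)" for e
    using inv_into_into[OF E[OF that]] f_inv_into_f[OF E[OF that]] by (simp_all add: h_def)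
  \<comment> \<open>Lists in \<open>C\<close> are compared after applying \<open>c\<close>, which is
    injective on nodes.\<close>
  have lists: "xs = map (fst h) ys"
    if "set xs \<subseteq> nodes C" "set ys \<subseteq> nodes (rL r)" "map (fst c) xs = map (fst m) ys" for xs ys
  proof (rule map_inj_on)
    show "map (fst c) xs = map (fst c) (map (fst h) ys)"
      unfolding that(3) using that(2) hV(2) by auto
    show "inj_on (fst c) (set xs \<union> set (map (fst h) ys))"
      using that(1,2) hV(1) by (intro inj_on_subset[OF inj(1)]) auto
  qed
  have "src C (snd h e) = map (fst h) (src (rL r) e) \<and> tgt C (snd h e) = map (fst h) (tgt (rL r) e) \<and>
    lab C (snd h e) = lab (rL r) e" if e: "e \<in> edges (rL r)" for e
  proof (intro conjI lists)
    note c = is_homD(3-5)[OF homc hE(1)[OF e], unfolded hE(2)[OF e]] and m = is_homD(3-5)[OF hom e]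
    show "map (fst c) (src C (snd h e)) = map (fst m) (src (rL r) e)"
      "map (fst c) (tgt C (snd h e)) = map (fst m) (tgt (rL r) e)" "lab C (snd h e) = lab (rL r) e"
      using c m by simp_all
  qed (use wfC(3,4)[OF hE(1)[OF e]] wf_hgraphD(3,4)[OF wfL e] in auto)
  then have "is_hom (rL r) C h" using hV hE by (auto simp: is_hom_def)
  moreover have "heq (rL r) (hcomp h c) m" using hV hE by (simp add: heq_def)
  ultimately show ?thesis by blast
qed

text \<open>The complements hidden in the definition are arbitrary. For whichever ones the pair
  carries, disjoint edge images would yield both factorisations and make it parallel.\<close>

lemma critical_pairD:
  fixes S :: "('w, 'f, 'l) hgraph"
  assumes "left_connected_rule Sig r1" "left_connected_rule Sig r2" "critical_pair Sig r1 r2 S m1 m2"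
  shows "rule_match Sig r1 S m1" "rule_match Sig r2 S m2"
    "\<exists>a\<in>edges (rL r1). \<exists>b\<in>edges (rL r2). snd m1 a = snd m2 b"
proof -
  interpret R1: left_connected Sig r1 by unfold_locales fact
  interpret R2: left_connected Sig r2 by unfold_locales fact
  obtain C1 :: "('w, 'f, 'l) hgraph" and k1 c1 and C2 :: "('w, 'f, 'l) hgraph" and k2 c2 where
    S: "ma_cospan Sig (discrete (ins S) :: ('w, 'f, 'l) hgraph) S (discrete (outs S) :: ('w, 'f, 'l) hgraph) (id, id) (id, id)"
    and C: "wf_hgraph Sig C1" "wf_hgraph Sig C2"
    and m: "convex_match (rL r1) S m1" "convex_match (rL r2) S m2"
    and po: "is_pushout (hsum (rI r1) (rO r1)) (rL r1) C1 S (copair (iL r1) (oL r1)) k1 m1 c1"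
      "is_pushout (hsum (rI r2) (rO r2)) (rL r2) C2 S (copair (iL r2) (oL r2)) k2 m2 c2"
    and np: "\<not> parallel (rL r1) (rL r2) m1 m2 C1 c1 C2 c2"
    using assms(3) unfolding critical_pair_def is_derivation_def by blast
  have S': "wf_hgraph Sig S" "mon_acyclic S" using S by (simp_all add: ma_cospan_discrete_iff)
  have m': "is_hom (rL r1) S m1" "is_hom (rL r2) S m2" "inj_on (snd m1) (edges (rL r1))" "inj_on (snd m2) (edges (rL r2))"
    using m by (auto simp: convex_match_def hmono_def)
  show "rule_match Sig r1 S m1" "rule_match Sig r2 S m2"
    by (unfold_locales; fact S' m')+
  have K: "hmono (hsum (rI r1) (rO r1)) (copair (iL r1) (oL r1))" "hmono (hsum (rI r2) (rO r2)) (copair (iL r2) (oL r2))"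
    using assms(1,2) by (auto simp: left_connected_rule_def)
  show "\<exists>a\<in>edges (rL r1). \<exists>b\<in>edges (rL r2). snd m1 a = snd m2 b"
  proof (rule ccontr)
    assume "\<not> ?thesis"
    then have d: "snd m1 ` edges (rL r1) \<inter> snd m2 ` edges (rL r2) = {}"
      "snd m2 ` edges (rL r2) \<inter> snd m1 ` edges (rL r1) = {}" by (auto dest: sym)
    show False
      using np R1.factor_through_complement[OF m'(1) po(2) K(2) C(2) d(1)]
        R2.factor_through_complement[OF m'(2) po(1) K(1) C(1) d(2)]
      unfolding parallel_def by blast
  qed
qed

section \<open>Overlaps\<close>

lemma indep_edgesI:
  assumes "M \<subseteq> A \<times> B" "\<And>a b c d. (a, b) \<in> M \<Longrightarrow> (c, d) \<in> M \<Longrightarrow> (a = c) = (b = d)"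
  shows "indep_edges A B M"
  unfolding indep_edges_def using assms by blast

text \<open>Serves both directions: \<open>M\<close> is a choice made by the procedure in the one,
  and the set of all edge coincidences of two given matches in the other.\<close>

locale overlap =
  fixes Sig :: "('l \<times> nat \<times> nat) set" and r1 r2 :: "('v, 'e, 'l) rule" and M :: "('e \<times> 'e) set"
  assumes lc: "left_connected_rule Sig r1" "left_connected_rule Sig r2"
    and indep: "indep_edges (edges (rL r1)) (edges (rL r2)) M"
    and labels: "\<And>a b. (a, b) \<in> M \<Longrightarrow> lab (rL r1) a = lab (rL r2) b"
begin

sublocale R1: left_connected Sig r1 by unfold_locales (rule lc)
sublocale R2: left_connected Sig r2 by unfold_locales (rule lc)

abbreviation "G0 \<equiv> induced_graph (rL r1) (rL r2) M"
abbreviation "S0 \<equiv> coeq G0 (hsum (rL r1) (rL r2)) (hcomp proj1 inj1) (hcomp proj2 inj2)"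
abbreviation "e0 \<equiv> coeq_map G0 (hcomp proj1 inj1) (hcomp proj2 inj2)"

abbreviation "S1 (N :: (('v + 'v) set \<times> ('v + 'v) set) set) \<equiv>
  coeq (discrete N :: (('v + 'v) set \<times> ('v + 'v) set, ('e + 'e) set, 'l) hgraph) S0 (fst, id) (snd, id)"
abbreviation e1 :: "(('v + 'v) set \<times> ('v + 'v) set) set \<Rightarrow> _" where
  "e1 N \<equiv> (gen_cls N, \<lambda>x :: ('e + 'e) set. {x})"

lemma M_edges: "(a, b) \<in> M \<Longrightarrow> a \<in> edges (rL r1)" "(a, b) \<in> M \<Longrightarrow> b \<in> edges (rL r2)"
  using indep by (auto simp: indep_edges_def)

lemma M_inj: "inj_on fst M" "inj_on snd M"
  using indep by (fastforce simp: indep_edges_def inj_on_def)+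

text \<open>Labels carry arity and coarity. With lists of different length \<open>zip\<close> in the
  induced graph would cut the longer one, and the projections would not preserve sources and
  targets.\<close>

lemma M_length:
  assumes "(a, b) \<in> M"
  shows "length (src (rL r1) a) = length (src (rL r2) b)" "length (tgt (rL r1) a) = length (tgt (rL r2) b)"
  using labels[OF assms] wf_hgraphD(6)[OF R1.wfL M_edges(1)[OF assms]] wf_hgraphD(6)[OF R2.wfL M_edges(2)[OF assms]]
  by simp_all

lemma G0_closed: "p \<in> edges G0 \<Longrightarrow> set (src G0 p) \<subseteq> nodes G0 \<and> set (tgt G0 p) \<subseteq> nodes G0"
  by (cases p) (fastforce simp: induced_graph_def in_set_zip)

lemma hom_G0:
  "is_hom G0 (hsum (rL r1) (rL r2)) (hcomp proj1 inj1)" "is_hom G0 (hsum (rL r1) (rL r2)) (hcomp proj2 inj2)"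
proof -
  have "is_hom G0 (rL r1) proj1" "is_hom G0 (rL r2) proj2"
    using M_edges labels wf_hgraphD(3,4)[OF R1.wfL _ nth_mem] wf_hgraphD(3,4)[OF R2.wfL _ nth_mem]
    by (auto simp: is_hom_def induced_graph_def proj1_def proj2_def M_length)
  then show "is_hom G0 (hsum (rL r1) (rL r2)) (hcomp proj1 inj1)" "is_hom G0 (hsum (rL r1) (rL r2)) (hcomp proj2 inj2)"
    by (auto intro: is_hom_hcomp is_hom_inj)
qed

lemma hom_e0: "is_hom (hsum (rL r1) (rL r2)) S0 e0"
  by (rule coeq_map_is_hom[OF hom_G0 G0_closed])

lemma wf_S0: "wf_hgraph Sig S0"
  by (rule wf_hepi[OF hom_e0 coeq_map_hepi wf_hsum[OF R1.wfL R2.wfL]])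

lemma hom_N:
  assumes "N \<subseteq> nodes S0 \<times> nodes S0"
  shows "is_hom (discrete N :: (_, ('e + 'e) set, 'l) hgraph) S0 (fst, id)"
    "is_hom (discrete N :: (_, ('e + 'e) set, 'l) hgraph) S0 (snd, id)"
  using assms by (auto simp: is_hom_def)

lemma hom_e1: "N \<subseteq> nodes S0 \<times> nodes S0 \<Longrightarrow> is_hom S0 (S1 N) (e1 N)"
  unfolding coeq_map_discrete[where 'l = 'l, symmetric] by (rule coeq_map_is_hom[OF hom_N]) auto

lemma hom_e: "N \<subseteq> nodes S0 \<times> nodes S0 \<Longrightarrow> is_hom (hsum (rL r1) (rL r2)) (S1 N) (hcomp e0 (e1 N))"
  by (rule is_hom_hcomp[OF hom_e0 hom_e1])

lemma hepi_e: "hepi (hsum (rL r1) (rL r2)) (S1 N) (hcomp e0 (e1 N))"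
  unfolding coeq_map_discrete[where 'l = 'l, symmetric] by (rule hepi_hcomp[OF coeq_map_hepi coeq_map_hepi])

lemma coeqE_G0: "coeqE G0 (hcomp proj1 inj1) (hcomp proj2 inj2) = {(Inl (fst p), Inr (snd p)) | p. p \<in> M}"
  by (auto simp: coeqE_def induced_graph_def proj1_def proj2_def)

text \<open>\<open>M\<close> is a partial bijection, so gluing along it never merges two edges of
  one left-hand side, and \<open>e1 N\<close> only wraps edges into singletons.\<close>

lemma inj_edges_e: "inj_on (snd (hcomp inj1 (hcomp e0 (e1 N)))) A" "inj_on (snd (hcomp inj2 (hcomp e0 (e1 N)))) A"
  by (rule inj_onI, rule glue_Inl_eq[OF M_inj(2), of fst], simp add: coeq_map_def coeqE_G0,
      rule inj_onI, rule glue_Inr_eq[OF M_inj(1), of snd], simp add: coeq_map_def coeqE_G0)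

lemma glued_edges: "(a, b) \<in> M \<Longrightarrow> snd (hcomp inj1 (hcomp e0 (e1 N))) a = snd (hcomp inj2 (hcomp e0 (e1 N))) b"
  by (auto simp: coeq_map_def coeqE_G0 intro!: gen_cls_eqI)

text \<open>Monogamy and acyclicity of the quotient, together with injectivity on edges, make both
  maps instances of \<open>rule_match\<close>; any pair in \<open>M\<close> provides the shared
  edge.\<close>

lemma overlap_critical:
  assumes "M \<noteq> {}" "N \<subseteq> nodes S0 \<times> nodes S0" "wf_hgraph Sig (S1 N)" "mon_acyclic (S1 N)"
  shows "hmono (rL r1) (hcomp inj1 (hcomp e0 (e1 N)))" "hmono (rL r2) (hcomp inj2 (hcomp e0 (e1 N)))"
    "critical_pair Sig r1 r2 (S1 N) (hcomp inj1 (hcomp e0 (e1 N))) (hcomp inj2 (hcomp e0 (e1 N)))"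
proof -
  interpret M1: rule_match Sig r1 "S1 N" "hcomp inj1 (hcomp e0 (e1 N))"
    by unfold_locales (rule assms is_hom_hsumD(1)[OF hom_e] inj_edges_e; fact)+
  interpret M2: rule_match Sig r2 "S1 N" "hcomp inj2 (hcomp e0 (e1 N))"
    by unfold_locales (rule assms is_hom_hsumD(2)[OF hom_e] inj_edges_e; fact)+
  show "hmono (rL r1) (hcomp inj1 (hcomp e0 (e1 N)))" "hmono (rL r2) (hcomp inj2 (hcomp e0 (e1 N)))"
    by (rule M1.hmono M2.hmono)+
  obtain a b where "(a, b) \<in> M" using assms(1) by auto
  then show "critical_pair Sig r1 r2 (S1 N) (hcomp inj1 (hcomp e0 (e1 N))) (hcomp inj2 (hcomp e0 (e1 N)))"
    by (intro critical_pairI[OF M1.rule_match_axioms M2.rule_match_axioms _ M_edges glued_edges])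
      (simp_all only: copair_hcomp_inj hepi_e)
qed

end

section \<open>Rebuilding a jointly surjective pair of matches from its overlap\<close>

locale match_pair = M1: rule_match Sig r1 X m1 + M2: rule_match Sig r2 X m2
  for Sig :: "('l \<times> nat \<times> nat) set" and r1 r2 :: "('v, 'e, 'l) rule"
    and X :: "('x, 'y, 'l) hgraph" and m1 m2 +
  assumes epi: "hepi (hsum (rL r1) (rL r2)) X (copair m1 m2)"
begin

definition M :: "('e \<times> 'e) set" where
  "M = {(a, b). a \<in> edges (rL r1) \<and> b \<in> edges (rL r2) \<and> snd m1 a = snd m2 b}"

sublocale overlap Sig r1 r2 M
proof
  show "indep_edges (edges (rL r1)) (edges (rL r2)) M"
    using M1.inj_edges M2.inj_edges 
    by (intro indep_edgesI) (auto simp: M_def dest: inj_onD, metis inj_onD)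
  show "lab (rL r1) a = lab (rL r2) b" if "(a, b) \<in> M" for a b
    using that is_homD(5)[OF M1.hom, of a] is_homD(5)[OF M2.hom, of b] by (auto simp: M_def)
qed (rule M1.rule M2.rule)+

lemma hom_pair: "is_hom (hsum (rL r1) (rL r2)) X (copair m1 m2)"
  using M1.hom M2.hom by (simp add: is_hom_copair)

abbreviation cls :: "'v + 'v \<Rightarrow> ('v + 'v) set" where
  "cls \<equiv> gen_cls (coeqV G0 (hcomp proj1 inj1) (hcomp proj2 inj2))"

abbreviation h0 :: "(('v + 'v) set, ('e + 'e) set, 'x, 'y) hmap" where
  "h0 \<equiv> coeq_desc (copair m1 m2)"

lemma G0_node:
  assumes "p \<in> nodes G0"
  shows "fst m1 (fst p) = fst m2 (snd p)"
proof -
  have *: "map (fst m1) (src (rL r1) a) = map (fst m2) (src (rL r2) b)"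
    "map (fst m1) (tgt (rL r1) a) = map (fst m2) (tgt (rL r2) b)" if "(a, b) \<in> M" for a b
    using that is_homD(3,4)[OF M1.hom, of a] is_homD(3,4)[OF M2.hom, of b] by (auto simp: M_def)
  from assms consider (s) a b k where "(a, b) \<in> M" "k < length (src (rL r1) a)" "k < length (src (rL r2) b)"
      "p = (src (rL r1) a ! k, src (rL r2) b ! k)"
    | (t) a b k where "(a, b) \<in> M" "k < length (tgt (rL r1) a)" "k < length (tgt (rL r2) b)"
      "p = (tgt (rL r1) a ! k, tgt (rL r2) b ! k)"
    by (auto simp: induced_graph_def)
  then show ?thesis
  proof cases
    case s
    then show ?thesis using arg_cong[OF *(1)[OF s(1)], of "\<lambda>xs. xs ! k"] by simp
  next
    case t
    then show ?thesis using arg_cong[OF *(2)[OF t(1)], of "\<lambda>xs. xs ! k"] by simp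
  qed
qed

lemma heq_h0: "heq G0 (hcomp (hcomp proj1 inj1) (copair m1 m2)) (hcomp (hcomp proj2 inj2) (copair m1 m2))"
  using G0_node unfolding heq_hsum_iff by (auto simp: heq_def proj1_def proj2_def induced_graph_def M_def)

lemma hom_h0: "is_hom S0 X h0"
  by (rule coeq_desc_is_hom[OF hom_G0 G0_closed hom_pair heq_h0])

lemma h0_cls [simp]: "fst h0 (cls z) = fst (copair m1 m2) z"
  by (rule coeq_desc_eq(1)[OF heq_h0])

text \<open>The map to \<open>X\<close> factors through \<open>S0\<close>, so equal classes have
  equal images, and each match is injective on nodes.\<close>

lemma cls_eqD:
  "cls (Inl u) = cls (Inl u') \<Longrightarrow> u \<in> nodes (rL r1) \<Longrightarrow> u' \<in> nodes (rL r1) \<Longrightarrow> u = u'"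
  "cls (Inr v) = cls (Inr v') \<Longrightarrow> v \<in> nodes (rL r2) \<Longrightarrow> v' \<in> nodes (rL r2) \<Longrightarrow> v = v'"
  "cls (Inl u) = cls (Inr v) \<Longrightarrow> fst m1 u = fst m2 v"
proof -
  have *: "fst (copair m1 m2) z = fst (copair m1 m2) z'" if "cls z = cls z'" for z z'
    using arg_cong[OF that, of "fst h0"] by (simp only: h0_cls)
  show "cls (Inl u) = cls (Inl u') \<Longrightarrow> u \<in> nodes (rL r1) \<Longrightarrow> u' \<in> nodes (rL r1) \<Longrightarrow> u = u'"
    by (drule *) (simp add: M1.m_eq_iff)
  show "cls (Inr v) = cls (Inr v') \<Longrightarrow> v \<in> nodes (rL r2) \<Longrightarrow> v' \<in> nodes (rL r2) \<Longrightarrow> v = v'"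
    by (drule *) (simp add: M2.m_eq_iff)
  show "cls (Inl u) = cls (Inr v) \<Longrightarrow> fst m1 u = fst m2 v"
    by (drule *) simp
qed

text \<open>For two sources with one image, monogamy of \<open>X\<close> forces the edges to have
  the same image and the positions to agree. The edges then form a pair in \<open>M\<close>, and
  \<open>(u, v)\<close> is one of the nodes it glues. Targets are treated alike.\<close>

lemma cls_glued:
  assumes ab: "a \<in> edges (rL r1)" "b \<in> edges (rL r2)" and eq: "fst m1 u = fst m2 v"
    and "u \<in> set (src (rL r1) a) \<and> v \<in> set (src (rL r2) b) \<or> u \<in> set (tgt (rL r1) a) \<and> v \<in> set (tgt (rL r2) b)"
  shows "cls (Inl u) = cls (Inr v)"
proof -
  have "(u, v) \<in> nodes G0"
    using assms(4)
  proof (elim disjE conjE)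
    assume "u \<in> set (src (rL r1) a)" "v \<in> set (src (rL r2) b)"
    then obtain i j where ij: "i < length (src (rL r1) a)" "j < length (src (rL r2) b)"
      "src (rL r1) a ! i = u" "src (rL r2) b ! j = v"
      by (meson in_set_conv_nth)
    have "snd m1 a = snd m2 b \<and> i = j"
      by (rule mon_acyclicD(3)[OF M1.maS M1.wfS])
        (use ab ij eq in \<open>simp_all add: is_homD[OF M1.hom] is_homD[OF M2.hom]\<close>)
    then show ?thesis using ab ij by (auto simp: induced_graph_def M_def)
  next
    assume "u \<in> set (tgt (rL r1) a)" "v \<in> set (tgt (rL r2) b)"
    then obtain i j where ij: "i < length (tgt (rL r1) a)" "j < length (tgt (rL r2) b)"
      "tgt (rL r1) a ! i = u" "tgt (rL r2) b ! j = v"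
      by (meson in_set_conv_nth)
    have "snd m1 a = snd m2 b \<and> i = j"
      by (rule mon_acyclicD(2)[OF M1.maS M1.wfS])
        (use ab ij eq in \<open>simp_all add: is_homD[OF M1.hom] is_homD[OF M2.hom]\<close>)
    then show ?thesis using ab ij by (auto simp: induced_graph_def M_def)
  qed
  then show ?thesis by (intro gen_cls_eqI) (force simp: coeqV_def proj1_def proj2_def)
qed

text \<open>The node coincidences of \<open>X\<close> that \<open>M\<close> does not account for and
  that the second quotient has to supply.\<close>

definition unglued :: "'v \<Rightarrow> 'v \<Rightarrow> bool" where
  "unglued u v \<longleftrightarrow> u \<in> nodes (rL r1) \<and> v \<in> nodes (rL r2) \<and> fst m1 u = fst m2 v \<and> cls (Inl u) \<noteq> cls (Inr v)"

text \<open>By \<open>cls_glued\<close> the two nodes cannot both have outgoing edges in their own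
  left-hand sides, nor both incoming ones. As neither is isolated, one has only outgoing and the
  other only incoming edges.\<close>

lemma unglued_cases:
  assumes "unglued u v"
  shows "u \<in> outs (rL r1) \<and> v \<in> ins (rL r2) \<or> u \<in> ins (rL r1) \<and> v \<in> outs (rL r2)"
proof -
  have *: "u \<in> nodes (rL r1)" "v \<in> nodes (rL r2)" "fst m1 u = fst m2 v" "cls (Inl u) \<noteq> cls (Inr v)"
    using assms by (auto simp: unglued_def)
  have "\<not> ((\<exists>a\<in>edges (rL r1). u \<in> set (src (rL r1) a)) \<and> (\<exists>b\<in>edges (rL r2). v \<in> set (src (rL r2) b)))"
    "\<not> ((\<exists>a\<in>edges (rL r1). u \<in> set (tgt (rL r1) a)) \<and> (\<exists>b\<in>edges (rL r2). v \<in> set (tgt (rL r2) b)))"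
    using cls_glued[OF _ _ *(3)] *(4) by blast+
  then show ?thesis
    using M1.in_or_out_edge[OF *(1)] M2.in_or_out_edge[OF *(2)] *(1,2)
    unfolding ins_iff[OF M1.wfL] ins_iff[OF M2.wfL] outs_iff[OF M1.wfL] outs_iff[OF M2.wfL] by blast
qed

text \<open>Edges glued by \<open>M\<close> can be viewed from either side, so the two cases
  overlap.\<close>

lemma S0_edge_cases:
  assumes "d \<in> edges S0"
  obtains (left) a where "a \<in> edges (rL r1)" "src S0 d = map (\<lambda>u. cls (Inl u)) (src (rL r1) a)"
      "tgt S0 d = map (\<lambda>u. cls (Inl u)) (tgt (rL r1) a)"
  | (right) b where "b \<in> edges (rL r2)" "src S0 d = map (\<lambda>v. cls (Inr v)) (src (rL r2) b)"
      "tgt S0 d = map (\<lambda>v. cls (Inr v)) (tgt (rL r2) b)"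
proof -
  have cls: "fst e0 = cls" by (simp add: coeq_map_def)
  obtain x where x: "x \<in> edges (hsum (rL r1) (rL r2))" "d = snd e0 x"
    using assms by (auto simp: coeq_simps coeq_map_def)
  note e0 = is_homD(3,4)[OF hom_e0 x(1), folded x(2), unfolded cls]
  show ?thesis
  proof (cases x)
    case (Inl a)
    then show ?thesis using left[of a] x e0 by (auto simp: o_def)
  next
    case (Inr b)
    then show ?thesis using right[of b] x e0 by (auto simp: o_def)
  qed
qed

text \<open>The procedure admits only nodes that are still inputs or outputs in \<open>S0\<close>.
  An offending edge from the same side would already touch the node itself; one from the other side
  would touch the partner node with the same class, although the pair is unglued.\<close>

lemma unglued_boundary:
  assumes "unglued u v"
  shows "u \<in> outs (rL r1) \<Longrightarrow> cls (Inl u) \<in> outs S0" "v \<in> ins (rL r2) \<Longrightarrow> cls (Inr v) \<in> ins S0"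
    "u \<in> ins (rL r1) \<Longrightarrow> cls (Inl u) \<in> ins S0" "v \<in> outs (rL r2) \<Longrightarrow> cls (Inr v) \<in> outs S0"
proof -
  have uv: "u \<in> nodes (rL r1)" "v \<in> nodes (rL r2)" "fst m1 u = fst m2 v" "cls (Inl u) \<noteq> cls (Inr v)"
    using assms by (auto simp: unglued_def)
  have n: "cls (Inl u) \<in> nodes S0" "cls (Inr v) \<in> nodes S0" using uv by (auto simp: coeq_simps)
  have ll: "u \<in> A" if A: "A \<subseteq> nodes (rL r1)" and im: "cls (Inl u) \<in> (\<lambda>u. cls (Inl u)) ` A" for A
  proof -
    obtain u' where u': "u' \<in> A" "cls (Inl u) = cls (Inl u')" using im by (rule imageE)
    then show ?thesis using cls_eqD(1)[OF u'(2) uv(1)] A by blast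
  qed
  have rr: "v \<in> A" if A: "A \<subseteq> nodes (rL r2)" and im: "cls (Inr v) \<in> (\<lambda>v. cls (Inr v)) ` A" for A
  proof -
    obtain v' where v': "v' \<in> A" "cls (Inr v) = cls (Inr v')" using im by (rule imageE)
    then show ?thesis using cls_eqD(2)[OF v'(2) uv(2)] A by blast
  qed
  have lr: False if A: "A \<subseteq> nodes (rL r2)" and im: "cls (Inl u) \<in> (\<lambda>v. cls (Inr v)) ` A" for A
  proof -
    obtain v' where v': "v' \<in> A" "cls (Inl u) = cls (Inr v')" using im by (rule imageE)
    have "v' = v" using cls_eqD(3)[OF v'(2)] uv(3) A v'(1)
      by (intro inj_onD[OF M2.inj_nodes]) (use uv(2) in auto)
    then show False using v'(2) uv(4) by simp
  qed
  have rl: False if A: "A \<subseteq> nodes (rL r1)" and im: "cls (Inr v) \<in> (\<lambda>u. cls (Inl u)) ` A" for A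
  proof -
    obtain u' where u': "u' \<in> A" "cls (Inr v) = cls (Inl u')" using im by (rule imageE)
    have "u' = u" using cls_eqD(3)[OF u'(2)[symmetric]] uv(3) A u'(1)
      by (intro inj_onD[OF M1.inj_nodes]) (use uv(1) in auto)
    then show False using u'(2) uv(4) by simp
  qed
  have s1: "set (src (rL r1) a) \<subseteq> nodes (rL r1)" and t1: "set (tgt (rL r1) a) \<subseteq> nodes (rL r1)"
    if "a \<in> edges (rL r1)" for a
    using wf_hgraphD(3,4)[OF M1.wfL that] by auto
  have s2: "set (src (rL r2) a) \<subseteq> nodes (rL r2)" and t2: "set (tgt (rL r2) a) \<subseteq> nodes (rL r2)"
    if "a \<in> edges (rL r2)" for a
    using wf_hgraphD(3,4)[OF M2.wfL that] by auto
  show "cls (Inl u) \<in> outs S0" if "u \<in> outs (rL r1)"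
    unfolding outs_iff[OF wf_S0]
  proof (intro conjI n ballI notI)
    fix d assume d: "d \<in> edges S0" and x: "cls (Inl u) \<in> set (src S0 d)"
    from d show False
    proof (cases rule: S0_edge_cases)
      case (left a)
      then have "u \<in> set (src (rL r1) a)" using ll[OF s1[OF left(1)]] x by simp
      then show False using that left(1) by (simp add: outs_iff[OF M1.wfL])
    next
      case (right a)
      then show False using lr[OF s2[OF right(1)]] x by simp
    qed
  qed
  show "cls (Inl u) \<in> ins S0" if "u \<in> ins (rL r1)"
    unfolding ins_iff[OF wf_S0]
  proof (intro conjI n ballI notI)
    fix d assume d: "d \<in> edges S0" and x: "cls (Inl u) \<in> set (tgt S0 d)"
    from d show False
    proof (cases rule: S0_edge_cases)
      case (left a)
      then have "u \<in> set (tgt (rL r1) a)" using ll[OF t1[OF left(1)]] x by simp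
      then show False using that left(1) by (simp add: ins_iff[OF M1.wfL])
    next
      case (right a)
      then show False using lr[OF t2[OF right(1)]] x by simp
    qed
  qed
  show "cls (Inr v) \<in> outs S0" if "v \<in> outs (rL r2)"
    unfolding outs_iff[OF wf_S0]
  proof (intro conjI n ballI notI)
    fix d assume d: "d \<in> edges S0" and x: "cls (Inr v) \<in> set (src S0 d)"
    from d show False
    proof (cases rule: S0_edge_cases)
      case (right a)
      then have "v \<in> set (src (rL r2) a)" using rr[OF s2[OF right(1)]] x by simp
      then show False using that right(1) by (simp add: outs_iff[OF M2.wfL])
    next
      case (left a)
      then show False using rl[OF s1[OF left(1)]] x by simp
    qed
  qed
  show "cls (Inr v) \<in> ins S0" if "v \<in> ins (rL r2)"
    unfolding ins_iff[OF wf_S0]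
  proof (intro conjI n ballI notI)
    fix d assume d: "d \<in> edges S0" and x: "cls (Inr v) \<in> set (tgt S0 d)"
    from d show False
    proof (cases rule: S0_edge_cases)
      case (right a)
      then have "v \<in> set (tgt (rL r2) a)" using rr[OF t2[OF right(1)]] x by simp
      then show False using that right(1) by (simp add: ins_iff[OF M2.wfL])
    next
      case (left a)
      then show False using rl[OF t1[OF left(1)]] x by simp
    qed
  qed
qed

definition N12 :: "(('v + 'v) set \<times> ('v + 'v) set) set" where
  "N12 = {(cls (Inl u), cls (Inr v)) | u v. unglued u v \<and> u \<in> ins (rL r1) \<and> v \<in> outs (rL r2)}"

definition N21 :: "(('v + 'v) set \<times> ('v + 'v) set) set" where
  "N21 = {(cls (Inr v), cls (Inl u)) | u v. unglued u v \<and> v \<in> ins (rL r2) \<and> u \<in> outs (rL r1)}"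

text \<open>Identifications in both directions would, by strong connectivity of both left-hand sides,
  close a cycle in X.\<close>

lemma one_direction: "N12 = {} \<or> N21 = {}"
proof (rule ccontr)
  assume "\<not> ?thesis"
  then obtain u v u' v' where 1: "u \<in> ins (rL r1)" "v \<in> outs (rL r2)" "fst m1 u = fst m2 v"
    and 2: "v' \<in> ins (rL r2)" "u' \<in> outs (rL r1)" "fst m1 u' = fst m2 v'"
    unfolding N12_def N21_def unglued_def by blast
  obtain e e' where "e \<in> edges X" "e' \<in> edges X" "fst m2 v' \<in> set (src X e)" "fst m2 v \<in> set (tgt X e')"
    "(e, e') \<in> (adj X)\<^sup>*"
    using M2.path_between[OF 2(1) 1(2)] .
  then show False using M1.no_return[OF 1(1) 2(2), of e e'] 1(3) 2(3) by simp
qed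

text \<open>Both components of an unglued pair have the same image in \<open>X\<close> and both
  matches are injective on nodes, so either component determines the other.\<close>

lemma indep_N12: "indep_edges (ins S0 \<inter> fst e0 ` Inl ` ins (rL r1)) (outs S0 \<inter> fst e0 ` Inr ` outs (rL r2)) N12"
proof (rule indep_edgesI)
  show "N12 \<subseteq> (ins S0 \<inter> fst e0 ` Inl ` ins (rL r1)) \<times> (outs S0 \<inter> fst e0 ` Inr ` outs (rL r2))"
    using unglued_boundary by (auto simp: N12_def coeq_map_def)
next
  fix a b c d
  have "(cls (Inl u) = cls (Inl u')) = (cls (Inr v) = cls (Inr v'))" if "unglued u v" "unglued u' v'" for u v u' v'
    using that cls_eqD(1)[of u u'] cls_eqD(2)[of v v'] M1.m_eq_iff[of u u'] M2.m_eq_iff[of v v']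
    by (auto simp: unglued_def)
  moreover assume "(a, b) \<in> N12" "(c, d) \<in> N12"
  ultimately show "(a = c) = (b = d)" unfolding N12_def by blast
qed

lemma indep_N21: "indep_edges (ins S0 \<inter> fst e0 ` Inr ` ins (rL r2)) (outs S0 \<inter> fst e0 ` Inl ` outs (rL r1)) N21"
proof (rule indep_edgesI)
  show "N21 \<subseteq> (ins S0 \<inter> fst e0 ` Inr ` ins (rL r2)) \<times> (outs S0 \<inter> fst e0 ` Inl ` outs (rL r1))"
    using unglued_boundary by (auto simp: N21_def coeq_map_def)
next
  fix a b c d
  have "(cls (Inr v) = cls (Inr v')) = (cls (Inl u) = cls (Inl u'))" if "unglued u v" "unglued u' v'" for u v u' v'
    using that cls_eqD(1)[of u u'] cls_eqD(2)[of v v'] M1.m_eq_iff[of u u'] M2.m_eq_iff[of v v']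
    by (auto simp: unglued_def)
  moreover assume "(a, b) \<in> N21" "(c, d) \<in> N21"
  ultimately show "(a = c) = (b = d)" unfolding N21_def by blast
qed

abbreviation "N \<equiv> N12 \<union> N21"

lemma indep_N:
  "indep_edges (ins S0 \<inter> fst e0 ` Inl ` ins (rL r1)) (outs S0 \<inter> fst e0 ` Inr ` outs (rL r2)) N \<or>
   indep_edges (ins S0 \<inter> fst e0 ` Inr ` ins (rL r2)) (outs S0 \<inter> fst e0 ` Inl ` outs (rL r1)) N"
  using one_direction
proof
  assume "N12 = {}"
  then have "N = N21" by simp
  then show ?thesis using indep_N21 by metis
next
  assume "N21 = {}"
  then have "N = N12" by simp
  then show ?thesis using indep_N12 by metis
qed

lemma N_nodes: "N \<subseteq> nodes S0 \<times> nodes S0"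
  by (auto simp: N12_def N21_def unglued_def coeq_simps)

text \<open>\<open>M\<close> contains every coincidence of edges between the two sides, and within
  one side the match is injective; nothing is left to identify after passing to
  \<open>S0\<close>.\<close>

lemma h0_inj_edges:
  assumes "x \<in> edges S0" "y \<in> edges S0" "snd h0 x = snd h0 y"
  shows "x = y"
proof -
  let ?c = "gen_cls (coeqE G0 (hcomp proj1 inj1) (hcomp proj2 inj2))"
  obtain d d' where d: "d \<in> edges (hsum (rL r1) (rL r2))" "d' \<in> edges (hsum (rL r1) (rL r2))" "x = ?c d" "y = ?c d'"
    using assms(1,2) by (auto simp: coeq_simps)
  have eq: "snd (copair m1 m2) d = snd (copair m1 m2) d'"
    using assms(3) unfolding d(3,4) coeq_desc_eq(2)[OF heq_h0] .
  have M: "?c (Inl a) = ?c (Inr b)" if "(a, b) \<in> M" for a b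
    using that by (intro gen_cls_eqI) (auto simp: coeqE_G0)
  show ?thesis
  proof (cases d)
    case l: (Inl a)
    show ?thesis
    proof (cases d')
      case (Inl a')
      with l d(1,2) eq have "a = a'" by (intro inj_onD[OF M1.inj_edges]) auto
      with l Inl d show ?thesis by simp
    next
      case (Inr b)
      with l d(1,2) eq have "(a, b) \<in> M" by (auto simp: M_def)
      with M l Inr d show ?thesis by simp
    qed
  next
    case r: (Inr b)
    show ?thesis
    proof (cases d')
      case (Inl a)
      with r d(1,2) eq have "(a, b) \<in> M" by (auto simp: M_def)
      with M r Inl d show ?thesis by simp
    next
      case (Inr b')
      with r d(1,2) eq have "b = b'" by (intro inj_onD[OF M2.inj_edges]) auto
      with r Inr d show ?thesis by simp
    qed
  qed
qed

text \<open>Within one side equal images mean equal nodes. Across the sides either the classes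
  already agree or the pair is unglued, and \<open>unglued_cases\<close> places it in
  \<open>N12\<close> or \<open>N21\<close>.\<close>

lemma h0_kernel:
  assumes "x \<in> nodes S0" "y \<in> nodes S0" "fst h0 x = fst h0 y"
  shows "x = y \<or> (x, y) \<in> N \<or> (y, x) \<in> N"
proof -
  obtain z z' where z: "z \<in> nodes (hsum (rL r1) (rL r2))" "z' \<in> nodes (hsum (rL r1) (rL r2))" "x = cls z" "y = cls z'"
    using assms(1,2) by (auto simp: coeq_simps)
  have eq: "fst (copair m1 m2) z = fst (copair m1 m2) z'" using assms(3) unfolding z(3,4) h0_cls .
  have uv: "cls (Inl u) = cls (Inr v) \<or> (cls (Inl u), cls (Inr v)) \<in> N \<or> (cls (Inr v), cls (Inl u)) \<in> N"
    if "u \<in> nodes (rL r1)" "v \<in> nodes (rL r2)" "fst m1 u = fst m2 v" for u v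
  proof (cases "cls (Inl u) = cls (Inr v)")
    case False
    with that have "unglued u v" by (simp add: unglued_def)
    with unglued_cases[OF this] show ?thesis unfolding N12_def N21_def by blast
  qed simp
  show ?thesis
  proof (cases z)
    case l: (Inl u)
    show ?thesis
    proof (cases z')
      case (Inl u')
      with l z(1,2) eq have "u = u'" by (intro inj_onD[OF M1.inj_nodes]) auto
      with l Inl z show ?thesis by simp
    next
      case (Inr v)
      with l z(1,2) eq have "u \<in> nodes (rL r1)" "v \<in> nodes (rL r2)" "fst m1 u = fst m2 v" by auto
      from uv[OF this] show ?thesis unfolding z(3,4) l Inr by blast
    qed
  next
    case r: (Inr v)
    show ?thesis
    proof (cases z')
      case (Inl u)
      with r z(1,2) eq have "u \<in> nodes (rL r1)" "v \<in> nodes (rL r2)" "fst m1 u = fst m2 v" by auto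
      from uv[OF this] show ?thesis unfolding z(3,4) r Inl by metis
    next
      case (Inr v')
      with r z(1,2) eq have "v = v'" by (intro inj_onD[OF M2.inj_nodes]) auto
      with r Inr z show ?thesis by simp
    qed
  qed
qed

lemma hepi_h0: "hepi S0 X h0"
  using epi unfolding hepi_def by (simp only: coeq_simps image_image h0_cls coeq_desc_eq(2)[OF heq_h0])

lemma heq_N: "heq (discrete N :: (_, ('e + 'e) set, 'l) hgraph) (hcomp (fst, id) h0) (hcomp (snd, id) h0)"
  by (auto simp: heq_def N12_def N21_def unglued_def)

lemma hiso_S1: "hiso (S1 N) X (coeq_desc h0)"
proof (rule coeq_hiso[OF hom_N[OF N_nodes] _ hom_h0 heq_N hepi_h0])
  fix x y assume "x \<in> nodes S0" "y \<in> nodes S0" "fst h0 x = fst h0 y"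
  from h0_kernel[OF this]
  show "gen_cls (coeqV (discrete N :: (_, ('e + 'e) set, 'l) hgraph) (fst, id) (snd, id)) x =
        gen_cls (coeqV (discrete N :: (_, ('e + 'e) set, 'l) hgraph) (fst, id) (snd, id)) y"
    unfolding coeq_discrete using gen_cls_eqI[of x y N] gen_cls_eqI[of y x N] by metis
next
  fix x y assume "x \<in> edges S0" "y \<in> edges S0" "snd h0 x = snd h0 y"
  from h0_inj_edges[OF this]
  show "gen_cls (coeqE (discrete N :: (_, ('e + 'e) set, 'l) hgraph) (fst, id) (snd, id)) x =
        gen_cls (coeqE (discrete N :: (_, ('e + 'e) set, 'l) hgraph) (fst, id) (snd, id)) y" by simp
qed simp

lemma wf_S1: "wf_hgraph Sig (S1 N)"
  by (rule wf_hepi[OF hom_e[OF N_nodes] hepi_e wf_hsum[OF M1.wfL M2.wfL]])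

text \<open>Pulled back from \<open>X\<close> along the isomorphism, so that the quotient passes the
  final check of the procedure.\<close>

lemma mon_acyclic_S1: "mon_acyclic (S1 N)"
  by (rule mon_acyclic_pullback[OF _ _ M1.maS M1.wfS wf_S1])
    (use hiso_S1 in \<open>auto simp: hiso_def bij_betw_def\<close>)

lemma heq_iso: "heq (hsum (rL r1) (rL r2)) (hcomp (hcomp e0 (e1 N)) (coeq_desc h0)) (copair m1 m2)"
proof -
  have "fst (coeq_desc h0) (fst (e1 N) (fst e0 z)) = fst (copair m1 m2) z"
    "snd (coeq_desc h0) (snd (e1 N) (snd e0 x)) = snd (copair m1 m2) x" for z x
    unfolding coeq_map_discrete[where 'l = 'l, symmetric]
    using coeq_desc_eq[OF heq_N] coeq_desc_eq[OF heq_h0] by (simp_all add: coeq_map_def)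
  then show ?thesis by (simp add: heq_def)
qed

end

section \<open>Correctness and exhaustiveness of the procedure\<close>

theorem mainTheorem7:
  fixes Sig :: "('l \<times> nat \<times> nat) set"
    and II :: "'i set"
    and rs :: "'i \<Rightarrow> ('v, 'e, 'l) rule"
  assumes "left_connected_system Sig II rs"
  shows "(\<forall>i\<in>II. \<forall>j\<in>II. \<forall>S e. alg_output Sig II rs i j S e \<longrightarrow>
            hmono (rL (rs i)) (hcomp inj1 e) \<and>
            hmono (rL (rs j)) (hcomp inj2 e) \<and>
            is_hom (hsum (rL (rs i)) (rL (rs j))) S e \<and>
            hepi (hsum (rL (rs i)) (rL (rs j))) S e \<and>
            ma_cospan Sig (discrete (ins S) :: (('v + 'v) set set, ('e + 'e) set set, 'l) hgraph) S
                          (discrete (outs S) :: (('v + 'v) set set, ('e + 'e) set set, 'l) hgraph) (id, id) (id, id) \<and>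
            critical_pair Sig (rs i) (rs j) S (hcomp inj1 e) (hcomp inj2 e))
       \<and> (\<forall>i\<in>II. \<forall>j\<in>II. \<forall>(X :: ('x, 'y, 'l) hgraph) h.
            is_hom (hsum (rL (rs i)) (rL (rs j))) X h \<and>
            hepi (hsum (rL (rs i)) (rL (rs j))) X h \<and>
            critical_pair Sig (rs i) (rs j) X (hcomp inj1 h) (hcomp inj2 h) \<longrightarrow>
            (\<exists>S e \<phi>. alg_output Sig II rs i j S e \<and> hiso S X \<phi> \<and>
                      heq (hsum (rL (rs i)) (rL (rs j))) (hcomp e \<phi>) h \<and>
                      fst \<phi> ` ins S = ins X \<and> fst \<phi> ` outs S = outs X))"
proof (rule conjI; intro ballI allI impI)
  fix i j S e assume ij: "i \<in> II" "j \<in> II" and out: "alg_output Sig II rs i j S e"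
  \<comment> \<open>The objects bound by \<open>Let\<close> are rewritten as those of
    \<open>overlap\<close> with explicit parameters, since the locale can be entered only after
    \<open>M\<close> has been obtained.\<close>
  obtain M N where indep: "indep_edges (edges (rL (rs i))) (edges (rL (rs j))) M"
    and labels: "\<forall>(a, b)\<in>M. lab (rL (rs i)) a = lab (rL (rs j)) b" and "M \<noteq> {}"
    and N: "indep_edges
        (ins (overlap.S0 (rs i) (rs j) M) \<inter> fst (overlap.e0 (rs i) (rs j) M) ` Inl ` ins (rL (rs i)))
        (outs (overlap.S0 (rs i) (rs j) M) \<inter> fst (overlap.e0 (rs i) (rs j) M) ` Inr ` outs (rL (rs j))) N \<or>
      indep_edges
        (ins (overlap.S0 (rs i) (rs j) M) \<inter> fst (overlap.e0 (rs i) (rs j) M) ` Inr ` ins (rL (rs j)))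
        (outs (overlap.S0 (rs i) (rs j) M) \<inter> fst (overlap.e0 (rs i) (rs j) M) ` Inl ` outs (rL (rs i))) N"
    and S: "S = overlap.S1 (rs i) (rs j) M N"
    and e: "e = hcomp (overlap.e0 (rs i) (rs j) M) (overlap.e1 N)"
    and ma: "ma_cospan Sig (discrete (ins S) :: (('v + 'v) set set, ('e + 'e) set set, 'l) hgraph) S
      (discrete (outs S) :: (('v + 'v) set set, ('e + 'e) set set, 'l) hgraph) (id, id) (id, id)"
    using out unfolding alg_output_def Let_def coeq_map_discrete by blast
  interpret overlap Sig "rs i" "rs j" M
    by unfold_locales (use assms ij indep labels in \<open>auto simp: left_connected_system_def\<close>)
  have N': "N \<subseteq> nodes S0 \<times> nodes S0"
    using N unfolding indep_edges_def by (auto dest!: subsetD intro: ins_outs_nodes)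
  have wf: "wf_hgraph Sig (S1 N)" "mon_acyclic (S1 N)"
    using ma unfolding S ma_cospan_discrete_iff by simp_all
  show "hmono (rL (rs i)) (hcomp inj1 e) \<and>
            hmono (rL (rs j)) (hcomp inj2 e) \<and>
            is_hom (hsum (rL (rs i)) (rL (rs j))) S e \<and>
            hepi (hsum (rL (rs i)) (rL (rs j))) S e \<and>
            ma_cospan Sig (discrete (ins S) :: (('v + 'v) set set, ('e + 'e) set set, 'l) hgraph) S
                          (discrete (outs S) :: (('v + 'v) set set, ('e + 'e) set set, 'l) hgraph) (id, id) (id, id) \<and>
            critical_pair Sig (rs i) (rs j) S (hcomp inj1 e) (hcomp inj2 e)"
    using overlap_critical[OF \<open>M \<noteq> {}\<close> N' wf] hom_e[OF N'] hepi_e ma unfolding S e by blast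
next
  fix i j and X :: "('x, 'y, 'l) hgraph" and h
  assume ij: "i \<in> II" "j \<in> II"
    and X: "is_hom (hsum (rL (rs i)) (rL (rs j))) X h \<and> hepi (hsum (rL (rs i)) (rL (rs j))) X h \<and>
      critical_pair Sig (rs i) (rs j) X (hcomp inj1 h) (hcomp inj2 h)"
  have lc: "left_connected_rule Sig (rs i)" "left_connected_rule Sig (rs j)"
    using assms ij by (auto simp: left_connected_system_def)
  note cp = critical_pairD[OF lc X[THEN conjunct2, THEN conjunct2]]
  interpret match_pair Sig "rs i" "rs j" X "hcomp inj1 h" "hcomp inj2 h"
    by (intro match_pair.intro cp match_pair_axioms.intro) (simp add: X copair_hcomp_inj)
  have ma: "ma_cospan Sig (discrete (ins (S1 N)) :: (('v + 'v) set set, ('e + 'e) set set, 'l) hgraph) (S1 N)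
      (discrete (outs (S1 N)) :: (('v + 'v) set set, ('e + 'e) set set, 'l) hgraph) (id, id) (id, id)"
    using wf_S1 mon_acyclic_S1 by (simp add: ma_cospan_discrete_iff)
  have "M \<noteq> {}" using cp(3) by (auto simp: M_def)
  then have "alg_output Sig II rs i j (S1 N) (hcomp e0 (e1 N))"
    unfolding alg_output_def Let_def coeq_map_discrete
    by (intro conjI ij exI[of _ M] exI[of _ N] indep labels indep_N ma refl) (use labels in auto)
  then show "\<exists>S e \<phi>. alg_output Sig II rs i j S e \<and> hiso S X \<phi> \<and>
      heq (hsum (rL (rs i)) (rL (rs j))) (hcomp e \<phi>) h \<and> fst \<phi> ` ins S = ins X \<and> fst \<phi> ` outs S = outs X"
    using hiso_S1[unfolded copair_hcomp_inj] heq_iso[unfolded copair_hcomp_inj]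
      hiso_ins_outs[OF hiso_S1 wf_S1 M1.wfS, unfolded copair_hcomp_inj] by blast
qed

end
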